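(* Let $G_{n,3}$ be a uniformly random cubic (3-regular) graph on $[n]$, $n$ even. Then w.h.p. $\chi_g(G_{n,3})=4$.
   Context: Coloring game: given a graph $G$ and a positive integer $k$, two players A and B alternately (A moves first) choose an uncolored vertex and assign it a color from $\{1,\dots,k\}$ so that the partial coloring stays proper. A wins if eventually all vertices are colored; B wins if at some point some uncolored vertex has all $k$ colors appearing among its neighbors. The game chromatic number $\chi_g(G)$ is the least $k$ for which A has a winning strategy. "W.h.p." means with probability tending to $1$ as $n\to\infty$. *)

theory Defs
  imports Complex_Main
begin

definition cubic_graphs :: "nat \<Rightarrow> nat set set set" where
  "cubic_graphs n = {E. E \<subseteq> {e. \<exists>u v. e = {u, v} \<and> u \<noteq> v \<and> u < n \<and> v < n}
                      \<and> (\<forall>v<n. card {e \<in> E. v \<in> e} = 3)}"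

definition nbr_colours :: "nat set set \<Rightarrow> (nat \<Rightarrow> nat option) \<Rightarrow> nat \<Rightarrow> nat set" where
  "nbr_colours E c v = {col. \<exists>u. {u, v} \<in> E \<and> c u = Some col}"

definition legal_move ::
  "nat set \<Rightarrow> nat set set \<Rightarrow> nat \<Rightarrow> (nat \<Rightarrow> nat option) \<Rightarrow> nat \<Rightarrow> nat \<Rightarrow> bool" where
  "legal_move V E k c v col \<longleftrightarrow> v \<in> V \<and> c v = None \<and> col \<in> {1..k}
       \<and> col \<notin> nbr_colours E c v"

definition all_coloured :: "nat set \<Rightarrow> (nat \<Rightarrow> nat option) \<Rightarrow> bool" where
  "all_coloured V c \<longleftrightarrow> (\<forall>v\<in>V. c v \<noteq> None)"

definition B_has_won :: "nat set \<Rightarrow> nat set set \<Rightarrow> nat \<Rightarrow> (nat \<Rightarrow> nat option) \<Rightarrow> bool" where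
  "B_has_won V E k c \<longleftrightarrow> (\<exists>v\<in>V. c v = None \<and> {1..k} \<subseteq> nbr_colours E c v)"

text \<open>Positions from which A has a winning strategy (the game is finite, so the
  least fixed point is exactly the set of A-winning positions).
  The boolean flag is True iff it is A's turn to move.\<close>
inductive A_wins :: "nat set \<Rightarrow> nat set set \<Rightarrow> nat \<Rightarrow> bool \<Rightarrow> (nat \<Rightarrow> nat option) \<Rightarrow> bool"
  for V E k where
  finished: "all_coloured V c \<Longrightarrow> A_wins V E k t c"
| A_move: "\<not> B_has_won V E k c \<Longrightarrow> \<not> all_coloured V c \<Longrightarrow> legal_move V E k c v col
     \<Longrightarrow> A_wins V E k False (c(v := Some col)) \<Longrightarrow> A_wins V E k True c"
| B_move: "\<not> B_has_won V E k c \<Longrightarrow> \<not> all_coloured V c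
     \<Longrightarrow> (\<And>v col. legal_move V E k c v col \<Longrightarrow> A_wins V E k True (c(v := Some col)))
     \<Longrightarrow> A_wins V E k False c"

definition game_chromatic_number :: "nat set \<Rightarrow> nat set set \<Rightarrow> nat" where
  "game_chromatic_number V E = (LEAST k. k > 0 \<and> A_wins V E k True (\<lambda>_. None))"

end

theory Submission
  imports Defs
begin

text \<open>With four colours no vertex of a cubic graph is ever blocked, and with at most two colours B
  blocks a neighbour of A's first vertex at once. With three colours B wins inside any tree-like
  neighbourhood of bounded radius that avoids A's first move: two coloured vertices joined by a path
  of even length in an otherwise uncoloured tree give B a sequence of forcing threats along the path
  that ends in a double threat, and B can reach such a configuration whatever A does.

  Switching a pair of edges shows that prescribing one more edge costs a factor \<open>9 / n\<close> in the number
  of cubic graphs. Hence a random cubic graph has at most \<open>9 ^ k\<close> expected cycles of length \<open>k\<close>, and by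
  Markov's inequality it has, with high probability, a vertex whose neighbourhood of the required
  radius is a tree and avoids the first move.\<close>

section \<open>The game with three colours\<close>

text \<open>The obstacle is parity. Threats run only along a path of even length, and A, not B,
  moves after B has set up a position, so B needs positions in which every reply of A fails. On a
  path of odd length B plants the colour of one end on a branch at distance 3 from that end. The two
  equal colours then have distances of opposite parity to every later vertex of the path, so one of
  them starts an even line. The few replies that spoil both lines repeat an end colour near that
  end. B mostly meets such a reply by planting one more copy of the colour on the adjacent branch
  and bending the path into it. The older copies then lie beside the new end and forbid A the same
  trick.

  The constants form a chain: 12 is a length at which parity no longer matters when B is to move; 25
  = 12 + 1 + 12 lets A cut the path anywhere; two bends raise 25 to 27, and B's own move that closes
  the window makes it 28. The outer neighbours of the leaves then lie within distance 31. When B has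
  coloured a centre, A still has a free move; hence two arms that meet only in the centre.\<close>

definition nb :: "nat set set \<Rightarrow> nat \<Rightarrow> nat set" where
  "nb E v = {u. {u, v} \<in> E}"

lemma nb_sym: "u \<in> nb E v \<longleftrightarrow> v \<in> nb E u"
  by (simp add: nb_def insert_commute)

lemma nbr_colours_nb: "col \<in> nbr_colours E c v \<longleftrightarrow> (\<exists>u\<in>nb E v. c u = Some col)"
  by (auto simp: nbr_colours_def nb_def)

text \<open>A blocked vertex is uncoloured, which refutes the rule \<open>finished\<close>; both
  move rules require that B has not won.\<close>

lemma B_has_won_imp_not_A_wins: "B_has_won V E k c \<Longrightarrow> \<not> A_wins V E k t c"
  by (erule contrapos_pn, erule A_wins.cases) (auto simp: B_has_won_def all_coloured_def)

lemma not_A_wins_B_move: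
  assumes "legal_move V E k c v col" "\<not> A_wins V E k True (c(v := Some col))"
  shows "\<not> A_wins V E k False c"
proof
  assume "A_wins V E k False c"
  then show False
    using assms by cases (auto simp: legal_move_def all_coloured_def)
qed

text \<open>The uncoloured vertex \<open>x\<close> rules out \<open>finished\<close>, so a win of A
  could only come from a move of A. With the preceding lemma this turns a strategy of B into a case
  distinction over A's replies.\<close>

lemma not_A_wins_A_move:
  assumes "x \<in> V" "c x = None"
    and "\<And>v col. legal_move V E k c v col \<Longrightarrow> \<not> A_wins V E k False (c(v := Some col))"
  shows "\<not> A_wins V E k True c"
proof
  assume "A_wins V E k True c"
  then show False
    using assms by cases (auto simp: all_coloured_def)
qed

text \<open>The three colours sum to 6, so \<open>6 - i - j\<close> is the colour missing from two
  distinct ones.\<close>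

lemma third_colour: "{i, j, 6 - i - j} = {1..3::nat}" "6 - i - j \<in> {1..3::nat}"
  "6 - i - j \<noteq> i" "6 - i - j \<noteq> j"
  if "i \<in> {1..3}" "j \<in> {1..3}" "i \<noteq> j" for i j :: nat
proof -
  have "(i = 1 \<or> i = 2 \<or> i = 3) \<and> (j = 1 \<or> j = 2 \<or> j = 3)" using that by auto
  then show "{i, j, 6 - i - j} = {1..3::nat}" "6 - i - j \<in> {1..3::nat}"
  "6 - i - j \<noteq> i" "6 - i - j \<noteq> j" using that by auto
qed

locale game3 =
  fixes V :: "nat set" and E :: "nat set set"
begin

text \<open>In both cases it is B who wins; B is to move in the first case, A in the second.\<close>

abbreviation B_wins_moving :: "(nat \<Rightarrow> nat option) \<Rightarrow> bool" where
  "B_wins_moving c \<equiv> \<not> A_wins V E 3 False c"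

abbreviation B_wins_waiting :: "(nat \<Rightarrow> nat option) \<Rightarrow> bool" where
  "B_wins_waiting c \<equiv> \<not> A_wins V E 3 True c"

text \<open>Two neighbours of \<open>y\<close> already show different colours, so B blocks
  \<open>y\<close> by giving its last neighbour \<open>z\<close> the third one; the final hypothesis
  is what makes this move legal.\<close>

lemma threat:
  assumes "y \<in> V" "z \<in> V" and yz: "y \<noteq> z" and "nb E y = {p, q, z}" "c y = None" "c z = None"
    and "c p = Some i" "c q = Some j" "i \<noteq> j" "i \<in> {1..3}" "j \<in> {1..3}"
    and "\<And>u. u \<in> nb E z \<Longrightarrow> c u \<noteq> Some (6 - i - j)"
  shows "B_wins_moving c"
proof -
  have l: "legal_move V E 3 c z (6 - i - j)"
    using assms third_colour[OF assms(10,11,9)] by (auto simp: legal_move_def nbr_colours_nb)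
  have "B_has_won V E 3 (c(z := Some (6 - i - j)))"
    unfolding B_has_won_def
  proof (intro bexI conjI)
    have "p \<noteq> z" "q \<noteq> z" using assms by auto
    then have "{i, j, 6 - i - j} \<subseteq> nbr_colours E (c(z := Some (6 - i - j))) y"
      using assms by (auto simp: nbr_colours_nb)
    then show "{1..3} \<subseteq> nbr_colours E (c(z := Some (6 - i - j))) y"
      unfolding third_colour(1)[OF assms(10,11,9)] .
  qed (use assms in auto)
  then show ?thesis using not_A_wins_B_move[OF l] B_has_won_imp_not_A_wins by blast
qed

end

section \<open>Windows: labelled tree neighbourhoods of a path\<close>

text \<open>Cells name the vertices of a window of length \<open>n\<close>: a path \<open>U 0, ..., U (n + 1)\<close> where \<open>T l\<close> is the
  third neighbour of \<open>U l\<close>, and \<open>A l\<close>, \<open>B l\<close> are the remaining neighbours of \<open>T l\<close>. The inner cells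
  are those all of whose neighbours are cells of the window. In a weak window the branches at even
  positions are cut off after \<open>T l\<close>.\<close>

datatype cell = U nat | T nat | A nat | B nat

fun in_window :: "nat \<Rightarrow> cell \<Rightarrow> bool" where
  "in_window n (U l) = (l \<le> n + 1)"
| "in_window n (T l) = (1 \<le> l \<and> l \<le> n)"
| "in_window n (A l) = (1 \<le> l \<and> l \<le> n)"
| "in_window n (B l) = (1 \<le> l \<and> l \<le> n)"

fun inner :: "nat \<Rightarrow> cell \<Rightarrow> bool" where
  "inner n (U l) = (1 \<le> l \<and> l \<le> n)"
| "inner n (T l) = (1 \<le> l \<and> l \<le> n)"
| "inner n _ = False"

fun cell_nb :: "cell \<Rightarrow> cell set" where
  "cell_nb (U l) = {U (l - 1), U (l + 1), T l}"
| "cell_nb (T l) = {U l, A l, B l}"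
| "cell_nb _ = {}"

fun shift_cell :: "nat \<Rightarrow> cell \<Rightarrow> cell" where
  "shift_cell k (U l) = U (l + k)"
| "shift_cell k (T l) = T (l + k)"
| "shift_cell k (A l) = A (l + k)"
| "shift_cell k (B l) = B (l + k)"

fun mirror_cell :: "nat \<Rightarrow> cell \<Rightarrow> cell" where
  "mirror_cell n (U l) = U (n + 1 - l)"
| "mirror_cell n (T l) = T (n + 1 - l)"
| "mirror_cell n (A l) = A (n + 1 - l)"
| "mirror_cell n (B l) = B (n + 1 - l)"

text \<open>The window along the path \<open>U 0, ..., U l, T l\<close>.\<close>

definition bend_cell :: "nat \<Rightarrow> cell \<Rightarrow> cell" where
  "bend_cell l x = (if x = U (l + 1) then T l else if x = T l then U (l + 1)
     else if x = A l then U (l + 2) else if x = B l then T (l + 1) else x)"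

text \<open>The window along the path \<open>T 2, U 2, U 3, ...\<close>\<close>

fun branch_cell :: "cell \<Rightarrow> cell" where
  "branch_cell (U l) = (if l = 0 then T 2 else U (l + 1))"
| "branch_cell (T l) = (if l = 1 then U 1 else T (l + 1))"
| "branch_cell (A l) = (if l = 1 then U 0 else A (l + 1))"
| "branch_cell (B l) = (if l = 1 then T 1 else B (l + 1))"

fun in_weak_window :: "nat \<Rightarrow> cell \<Rightarrow> bool" where
  "in_weak_window n (U l) = (l \<le> n + 1)"
| "in_weak_window n (T l) = (1 \<le> l \<and> l \<le> n)"
| "in_weak_window n (A l) = (odd l \<and> l \<le> n)"
| "in_weak_window n (B l) = (odd l \<and> l \<le> n)"

fun weak_inner :: "nat \<Rightarrow> cell \<Rightarrow> bool" where
  "weak_inner n (U l) = (1 \<le> l \<and> l \<le> n)"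
| "weak_inner n (T l) = (odd l \<and> l \<le> n)"
| "weak_inner n _ = False"

lemma weak_window_imp_window: "in_weak_window n x \<Longrightarrow> in_window n x"
  by (cases x) (auto elim: oddE)

lemma weak_inner_imp_inner: "weak_inner n x \<Longrightarrow> inner n x"
  by (cases x) (auto elim: oddE)

lemma inner_imp_window: "inner n x \<Longrightarrow> in_window n x"
  by (cases x) auto

context game3
begin

text \<open>The window is a map from labels to vertices, so passing to another path in the same tree
  is precomposition with a map of labels.\<close>

definition spine :: "nat \<Rightarrow> (cell \<Rightarrow> nat) \<Rightarrow> bool" where
  "spine n w \<longleftrightarrow> inj_on w {x. in_window n x} \<and> (\<forall>x. in_window n x \<longrightarrow> w x \<in> V) \<and>
     (\<forall>x. inner n x \<longrightarrow> nb E (w x) = w ` cell_nb x)"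

lemma spineD:
  assumes "spine n w"
  shows "in_window n x \<Longrightarrow> w x \<in> V"
    and "in_window n x \<Longrightarrow> in_window n y \<Longrightarrow> w x = w y \<longleftrightarrow> x = y"
    and "inner n x \<Longrightarrow> nb E (w x) = w ` cell_nb x"
  using assms by (auto simp: spine_def inj_on_def)

text \<open>Serves lines that are prolonged through a leaf of a given window: there the vertex
  beside the last even position may be the end of that window, whose further neighbours have no
  label.\<close>

definition weak_spine :: "nat \<Rightarrow> (cell \<Rightarrow> nat) \<Rightarrow> bool" where
  "weak_spine n w \<longleftrightarrow> inj_on w {x. in_weak_window n x} \<and> (\<forall>x. in_weak_window n x \<longrightarrow> w x \<in> V) \<and>
     (\<forall>x. weak_inner n x \<longrightarrow> nb E (w x) = w ` cell_nb x)"

lemma weak_spineD: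
  assumes "weak_spine n w"
  shows "in_weak_window n x \<Longrightarrow> w x \<in> V"
    and "in_weak_window n x \<Longrightarrow> in_weak_window n y \<Longrightarrow> w x = w y \<longleftrightarrow> x = y"
    and "weak_inner n x \<Longrightarrow> nb E (w x) = w ` cell_nb x"
  using assms by (auto simp: weak_spine_def inj_on_def)

lemma spine_imp_weak_spine: "spine n w \<Longrightarrow> weak_spine n w"
  unfolding spine_def weak_spine_def inj_on_def using weak_window_imp_window weak_inner_imp_inner by blast

text \<open>A shift by 2 keeps the parity of positions, hence the cut-off branches stay at even
  positions; this is the inductive step of the threat sequence.\<close>

lemma weak_spine_shift2:
  assumes "weak_spine n w" "2 \<le> n"
  shows "weak_spine (n - 2) (w \<circ> shift_cell 2)"
proof -
  have 1: "in_weak_window n (shift_cell 2 x)" if "in_weak_window (n - 2) x" for x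
    using that assms(2) by (cases x) auto
  have 2: "weak_inner n (shift_cell 2 x) \<and> cell_nb (shift_cell 2 x) = shift_cell 2 ` cell_nb x" if "weak_inner (n - 2) x" for x
    using that assms(2) by (cases x) auto
  have "inj_on (w \<circ> shift_cell 2) {x. in_weak_window (n - 2) x}"
  proof (rule comp_inj_on)
    show "inj_on (shift_cell 2) {x. in_weak_window (n - 2) x}" by (rule inj_onI) (auto elim!: shift_cell.elims)
    show "inj_on w (shift_cell 2 ` {x. in_weak_window (n - 2) x})"
      using assms(1) 1 unfolding weak_spine_def by (auto elim!: inj_on_subset)
  qed
  then show ?thesis using assms(1) 1 2 by (auto simp: weak_spine_def image_comp[symmetric])
qed

lemma spine_map:
  assumes "spine n w" "inj_on h {x. in_window m x}" "\<And>x. in_window m x \<Longrightarrow> in_window n (h x)"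
    and "\<And>x. inner m x \<Longrightarrow> inner n (h x) \<and> cell_nb (h x) = h ` cell_nb x"
  shows "spine m (w \<circ> h)"
proof -
  have "inj_on (w \<circ> h) {x. in_window m x}"
    using assms(1-3) unfolding spine_def
    by (intro comp_inj_on) (auto elim!: inj_on_subset)
  then show ?thesis
    using assms by (auto simp: spine_def image_comp[symmetric])
qed

lemma spine_cut: "spine n w \<Longrightarrow> l \<le> n \<Longrightarrow> spine l w"
  using spine_map[of n w "\<lambda>x. x" l] 
  by (force simp: comp_def inj_on_def elim: inner.elims in_window.elims)

lemma spine_shift: "spine n w \<Longrightarrow> k \<le> n \<Longrightarrow> spine (n - k) (w \<circ> shift_cell k)"
proof (rule spine_map, assumption)
  show "inj_on (shift_cell k) {x. in_window (n - k) x}"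
    by (rule inj_onI) (auto elim!: shift_cell.elims)
qed (auto elim!: in_window.elims inner.elims)

lemma spine_mirror: "spine n w \<Longrightarrow> spine n (w \<circ> mirror_cell n)"
proof (rule spine_map, assumption)
  show "inj_on (mirror_cell n) {x. in_window n x}"
    by (rule inj_onI) (auto elim!: in_window.elims)
qed (auto elim!: in_window.elims inner.elims simp: Suc_diff_le)

text \<open>\<open>l < n\<close> is required because the discarded rest of the path becomes the
  branch at \<open>l\<close>: \<open>U (l + 2)\<close> and \<open>T (l + 1)\<close> are its two
  leaves.\<close>

lemma spine_bend: "spine n w \<Longrightarrow> 1 \<le> l \<Longrightarrow> l < n \<Longrightarrow> spine l (w \<circ> bend_cell l)"
proof (rule spine_map, assumption)
  show "inj_on (bend_cell l) {x. in_window l x}"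
    by (rule inj_onI) (auto elim!: in_window.elims simp: bend_cell_def split: if_splits)
  fix x assume "1 \<le> l" "l < n"
  show "in_window l x \<Longrightarrow> in_window n (bend_cell l x)"
    using \<open>1 \<le> l\<close> \<open>l < n\<close> by (auto elim!: in_window.elims simp: bend_cell_def)
  assume "inner l x"
  then show "inner n (bend_cell l x) \<and> cell_nb (bend_cell l x) = bend_cell l ` cell_nb x"
    using \<open>1 \<le> l\<close> \<open>l < n\<close> by (auto elim!: inner.elims simp: bend_cell_def)
qed

text \<open>The path from \<open>T 2\<close> has one edge less than the path from
  \<open>U 0\<close>, so this is the map that changes parity. The old end \<open>U 0\<close> and its
  sibling \<open>T 1\<close> turn into the leaves \<open>A 1\<close> and \<open>B 1\<close>.\<close>

lemma spine_branch: "spine n w \<Longrightarrow> 2 \<le> n \<Longrightarrow> spine (n - 1) (w \<circ> branch_cell)"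
proof (rule spine_map, assumption)
  show "inj_on branch_cell {x. in_window (n - 1) x}"
    by (rule inj_onI) (auto elim!: in_window.elims split: if_splits)
  fix x assume "2 \<le> n"
  show "in_window (n - 1) x \<Longrightarrow> in_window n (branch_cell x)"
    using \<open>2 \<le> n\<close> by (auto elim!: in_window.elims)
  assume "inner (n - 1) x"
  then show "inner n (branch_cell x) \<and> cell_nb (branch_cell x) = branch_cell ` cell_nb x"
    using \<open>2 \<le> n\<close> by (auto elim!: inner.elims simp: numeral_2_eq_2 split: if_splits)
qed

lemma spine_upd:
  assumes "spine n w" "in_window n x" "in_window n y"
  shows "(c(w x := v)) (w y) = (if y = x then v else c (w y))"
  using spineD(2)[OF assms(1,3,2)] by auto

lemma weak_spine_upd:
  assumes "weak_spine n w" "in_weak_window n x" "in_weak_window n y"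
  shows "(c(w x := v)) (w y) = (if y = x then v else c (w y))"
  using weak_spineD(2)[OF assms(1,3,2)] by auto

text \<open>B colours \<open>U 2\<close> with \<open>g 1\<close> and thereby threatens to block \<open>U 1\<close> by a move at \<open>T 1\<close>. The only
  answers that stop this are in the closed neighbourhood of \<open>T 1\<close>, and they leave the line
  that starts at \<open>U 2\<close> untouched.\<close>

lemma alternating_line:
  assumes "weak_spine n w" "n + 1 = 2 * m" "1 \<le> m"
    and "\<And>k. k \<le> m \<Longrightarrow> g k \<in> {1..3}" "\<And>k. k < m \<Longrightarrow> g k \<noteq> g (Suc k)"
    and "c (w (U 0)) = Some (g 0)" "c (w (U (2 * m))) = Some (g m)"
    and "\<And>k. k < m \<Longrightarrow> c (w (U (2 * k + 1))) = None \<and> c (w (T (2 * k + 1))) = None \<and>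
           c (w (A (2 * k + 1))) \<noteq> Some (6 - g k - g (Suc k)) \<and>
           c (w (B (2 * k + 1))) \<noteq> Some (6 - g k - g (Suc k))"
    and "\<And>k. 0 < k \<Longrightarrow> k < m \<Longrightarrow> c (w (U (2 * k))) = None \<and> c (w (T (2 * k))) \<noteq> Some (g k)"
  shows "B_wins_moving c"
  using assms
proof (induction m arbitrary: n w g c)
  case 0
  then show ?case by simp
next
  case (Suc m)
  note sp = \<open>weak_spine n w\<close>
  have n: "n = 2 * m + 1" using Suc.prems(2) by simp
  have in1: "in_weak_window n (U 0)" "in_weak_window n (U 1)" "in_weak_window n (U 2)" "in_weak_window n (T 1)" "in_weak_window n (A 1)" "in_weak_window n (B 1)"
    using n by auto
  have nbU1: "nb E (w (U 1)) = {w (U 0), w (U 2), w (T 1)}"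
    using weak_spineD(3)[OF sp, of "U 1"] n by (simp add: numeral_2_eq_2)
  have nbT1: "nb E (w (T 1)) = {w (U 1), w (A 1), w (B 1)}"
    using weak_spineD(3)[OF sp, of "T 1"] n by simp
  have g01: "g 0 \<in> {1..3}" "g 1 \<in> {1..3}" "g 0 \<noteq> g 1"
    using Suc.prems(4)[of 0] Suc.prems(4)[of 1] Suc.prems(5)[of 0] by auto
  have thr: "B_wins_moving d" if "d (w (U 0)) = Some (g 0)" "d (w (U 2)) = Some (g 1)" "d (w (U 1)) = None"
    "d (w (T 1)) = None" "d (w (A 1)) \<noteq> Some (6 - g 0 - g 1)" "d (w (B 1)) \<noteq> Some (6 - g 0 - g 1)" for d
    using weak_spineD(2)[OF sp in1(2,4)] that nbT1
    by (intro threat[OF weak_spineD(1)[OF sp in1(2)] weak_spineD(1)[OF sp in1(4)] _ nbU1 that(3,4,1,2) g01(3,1,2)]) auto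
  show ?case
  \<comment> \<open>Two edges are left: \<open>U 0\<close> and \<open>U 2\<close> are the
    differently coloured ends, and the threat at \<open>U 1\<close> is executed at once.\<close>
  proof (cases "m = 0")
    case True
    then show ?thesis using Suc.prems(8)[of 0] Suc.prems(6,7) by (intro thr) auto
  next
    case False
    define c1 where "c1 = c(w (U 2) := Some (g 1))"
    have nbU2: "nb E (w (U 2)) = {w (U 1), w (U 3), w (T 2)}"
      using weak_spineD(3)[OF sp, of "U 2"] n False by (simp add: numeral_eq_Suc)
    have leg: "legal_move V E 3 c (w (U 2)) (g 1)"
      using Suc.prems(8)[of 0] Suc.prems(8)[of 1] Suc.prems(9)[of 1] g01 False weak_spineD(1)[OF sp in1(3)] nbU2
      by (auto simp: legal_move_def nbr_colours_nb numeral_eq_Suc)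
    have upd: "c1 (w y) = (if y = U 2 then Some (g 1) else c (w y))" if "in_weak_window n y" for y
      unfolding c1_def using weak_spine_upd[OF sp in1(3) that, of c "Some (g 1)"] by simp
    have "B_wins_waiting c1"
    proof (rule not_A_wins_A_move)
      show "w (U 1) \<in> V" using weak_spineD(1)[OF sp in1(2)] .
      show "c1 (w (U 1)) = None" using upd[OF in1(2)] Suc.prems(8)[of 0] by simp
      fix v col assume l: "legal_move V E 3 c1 v col"
      define c2 where "c2 = c1(v := Some col)"
      show "B_wins_moving c2"
      proof (cases "v \<in> w ` {U 1, T 1, A 1, B 1}")
        case True
        then obtain x where x: "v = w x" "x \<in> {U 1, T 1, A 1, B 1}" by auto
        have inx: "in_weak_window n x" using x in1 by auto
        have upd2: "c2 (w y) = (if y = x then Some col else if y = U 2 then Some (g 1) else c (w y))" if "in_weak_window n y" for y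
          unfolding c2_def x(1) using weak_spine_upd[OF sp inx that, of c1 "Some col"] upd[OF that] by simp
        show ?thesis
        proof (rule Suc.IH)
          show "weak_spine (n - 2) (w \<circ> shift_cell 2)" using weak_spine_shift2[OF sp] n False by simp
          show "n - 2 + 1 = 2 * m" "1 \<le> m" using n False by auto
          show "(g \<circ> Suc) k \<in> {1..3}" if "k \<le> m" for k using Suc.prems(4)[of "Suc k"] that by simp
          show "(g \<circ> Suc) k \<noteq> (g \<circ> Suc) (Suc k)" if "k < m" for k using Suc.prems(5)[of "Suc k"] that by simp
          show "c2 ((w \<circ> shift_cell 2) (U 0)) = Some ((g \<circ> Suc) 0)"
            using upd2[OF in1(3)] x by (auto simp: numeral_2_eq_2)
          show "c2 ((w \<circ> shift_cell 2) (U (2 * m))) = Some ((g \<circ> Suc) m)"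
            using upd2[of "U (2 * m + 2)"] x n False Suc.prems(7) by (auto simp: numeral_eq_Suc)
          show "c2 ((w \<circ> shift_cell 2) (U (2 * k + 1))) = None \<and> c2 ((w \<circ> shift_cell 2) (T (2 * k + 1))) = None \<and>
             c2 ((w \<circ> shift_cell 2) (A (2 * k + 1))) \<noteq> Some (6 - (g \<circ> Suc) k - (g \<circ> Suc) (Suc k)) \<and>
             c2 ((w \<circ> shift_cell 2) (B (2 * k + 1))) \<noteq> Some (6 - (g \<circ> Suc) k - (g \<circ> Suc) (Suc k))" if "k < m" for k
          proof -
            have i3: "in_weak_window n (U (2 * k + 3))" "in_weak_window n (T (2 * k + 3))" "in_weak_window n (A (2 * k + 3))" "in_weak_window n (B (2 * k + 3))"
              using that n by auto
            show ?thesis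
              using upd2[OF i3(1)] upd2[OF i3(2)] upd2[OF i3(3)] upd2[OF i3(4)]
                Suc.prems(8)[of "Suc k"] x n that by (auto simp: numeral_eq_Suc)
          qed
          show "c2 ((w \<circ> shift_cell 2) (U (2 * k))) = None \<and> c2 ((w \<circ> shift_cell 2) (T (2 * k))) \<noteq> Some ((g \<circ> Suc) k)"
            if "0 < k" "k < m" for k
            using upd2[of "U (2 * k + 2)"] upd2[of "T (2 * k + 2)"]
              Suc.prems(9)[of "Suc k"] x n that by (auto simp: numeral_eq_Suc)
        qed
      next
        case ov: False
        have "v \<noteq> w (U 0)" "v \<noteq> w (U 2)"
          using l Suc.prems(6) upd[OF in1(1)] upd[OF in1(3)] by (auto simp: legal_move_def)
        then show ?thesis
          using ov upd[OF in1(1)] upd[OF in1(2)] upd[OF in1(3)] upd[OF in1(4)] upd[OF in1(5)] upd[OF in1(6)]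
            Suc.prems(8)[of 0] Suc.prems(6)
          by (intro thr) (auto simp: c2_def)
      qed
    qed
    then show ?thesis using not_A_wins_B_move[OF leg] by (simp add: c1_def)
  qed
qed

end

section \<open>Walks in the triangle of the three colours\<close>

definition colour_walk :: "nat \<Rightarrow> nat \<Rightarrow> nat \<Rightarrow> (nat \<Rightarrow> nat) \<Rightarrow> bool" where
  "colour_walk m p q g \<longleftrightarrow> g 0 = p \<and> g m = q \<and> (\<forall>k\<le>m. g k \<in> {1..3}) \<and> (\<forall>k<m. g k \<noteq> g (Suc k))"

lemma colour_walk_0: "p \<in> {1..3} \<Longrightarrow> colour_walk 0 p p (\<lambda>_. p)"
  by (simp add: colour_walk_def)

lemma colour_walk_Suc:
  assumes "colour_walk m p q g" "r \<in> {1..3}" "r \<noteq> p"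
  shows "colour_walk (Suc m) r q (\<lambda>k. case k of 0 \<Rightarrow> r | Suc j \<Rightarrow> g j)"
  using assms unfolding colour_walk_def by (auto simp: less_Suc_eq_0_disj split: nat.split)

lemma colour_avoiding2: "\<exists>r\<in>{1..3::nat}. r \<noteq> p \<and> r \<noteq> q"
proof -
  have "card {1..3::nat} > card {p, q}" using card_insert_le_m1[of 2 "{q}" p] by simp
  then show ?thesis by (metis card_mono finite.emptyI finite_insert insert_iff linorder_not_le subsetI)
qed

text \<open>Two vertices of a triangle, equal or not, are joined in two steps by way of a colour
  different from both; longer walks reduce to this one step at a time.\<close>

lemma colour_walk_ex:
  "p \<in> {1..3} \<Longrightarrow> q \<in> {1..3} \<Longrightarrow> 2 \<le> m \<or> (m = 1 \<and> p \<noteq> q) \<or> (m = 0 \<and> p = q) \<Longrightarrow> \<exists>g. colour_walk m p q g"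
proof (induction m arbitrary: p)
  case 0
  then show ?case using colour_walk_0 by auto
next
  case (Suc m)
  have "\<exists>r\<in>{1..3}. r \<noteq> p \<and> (2 \<le> m \<or> (m = 1 \<and> r \<noteq> q) \<or> (m = 0 \<and> r = q))"
    using Suc.prems colour_avoiding2[of p q] by (cases "m = 0"; cases "m = 1") auto
  then obtain r where "r \<in> {1..3}" "r \<noteq> p" "\<exists>g. colour_walk m r q g" using Suc.IH Suc.prems by blast
  then show ?case using colour_walk_Suc Suc.prems by metis
qed

lemma colour_walk_append:
  assumes "colour_walk m p q g" "colour_walk n q r h"
  shows "colour_walk (m + n) p r (\<lambda>k. if k \<le> m then g k else h (k - m))"
  using assms unfolding colour_walk_def
  by (auto simp: Suc_diff_le not_le less_Suc_eq_le)

lemma colour_cases: "p \<in> {1..3::nat} \<longleftrightarrow> p = 1 \<or> p = 2 \<or> p = 3"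
  by auto

text \<open>The third colour of step \<open>e\<close> is the one that B threatens to play at
  \<open>T (2 * e + 1)\<close>, so this avoids a colour \<open>d\<close> on a leaf there. The parts
  before and after the step have total length at least 3, so one of them has length at least 2 and
  imposes no condition; the step is built from the constrained side.\<close>

lemma colour_walk_ex_step:
  assumes "p \<in> {1..3}" "q \<in> {1..3}" "4 \<le> m" "e < m"
  shows "\<exists>g. colour_walk m p q g \<and> 6 - g e - g (Suc e) \<noteq> d"
proof -
  have "\<exists>a\<in>{1..3}. \<exists>b\<in>{1..3}. a \<noteq> b \<and> 6 - a - b \<noteq> d \<and>
      (2 \<le> e \<or> (e = 1 \<and> p \<noteq> a) \<or> (e = 0 \<and> p = a)) \<and>
      (2 \<le> m - Suc e \<or> (m - Suc e = 1 \<and> b \<noteq> q) \<or> (m - Suc e = 0 \<and> b = q))"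
  proof -
    have ab: "\<exists>b\<in>{1..3}. a \<noteq> b \<and> 6 - a - b \<noteq> d" if "a \<in> {1..3}" for a
    proof -
      have "\<exists>b\<in>{1,2,3}. a \<noteq> b \<and> 6 - a - b \<noteq> d"
        using that unfolding colour_cases by (elim disjE) auto
      then show ?thesis by (auto simp: colour_cases)
    qed
    consider "2 \<le> m - Suc e" "e = 0" | "2 \<le> m - Suc e" "e \<noteq> 0"
      | "m - Suc e = 0" "2 \<le> e" | "m - Suc e = 1" "2 \<le> e"
      using assms(3,4) by linarith
    then show ?thesis
    proof cases
      case 1 then show ?thesis using ab[OF assms(1)] assms(1) by (metis (no_types))
    next
      case 2
      obtain a where "a \<in> {1..3}" "a \<noteq> p" using colour_avoiding2[of p p] by auto
      then show ?thesis using ab[of a] 2 by (metis (no_types) One_nat_def Suc_leI le_neq_implies_less nat_neq_iff not_less_eq_eq less_Suc0 numeral_2_eq_2 not_le)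
    next
      case 3
      then obtain a where "a \<in> {1..3}" "q \<noteq> a" "6 - q - a \<noteq> d" using ab[OF assms(2)] by auto
      then have "a \<in> {1..3}" "a \<noteq> q" "6 - a - q \<noteq> d" by (auto simp: diff_commute add.commute)
      then show ?thesis using 3 assms(2) by blast
    next
      case 4
      obtain b where b: "b \<in> {1..3}" "b \<noteq> q" using colour_avoiding2[of q q] by auto
      then obtain a where "a \<in> {1..3}" "b \<noteq> a" "6 - b - a \<noteq> d" using ab[of b] by auto
      then have "a \<in> {1..3}" "a \<noteq> b" "6 - a - b \<noteq> d" by (auto simp: diff_commute add.commute)
      then show ?thesis using 4 b by blast
    qed
  qed
  then obtain a b where ab: "a \<in> {1..3}" "b \<in> {1..3}" "a \<noteq> b" "6 - a - b \<noteq> d"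
    "2 \<le> e \<or> (e = 1 \<and> p \<noteq> a) \<or> (e = 0 \<and> p = a)"
    "2 \<le> m - Suc e \<or> (m - Suc e = 1 \<and> b \<noteq> q) \<or> (m - Suc e = 0 \<and> b = q)" by blast
  obtain g where g: "colour_walk e p a g" using colour_walk_ex[OF assms(1) ab(1,5)] by blast
  obtain h where h: "colour_walk (m - Suc e) b q h" using colour_walk_ex[OF ab(2) assms(2) ab(6)] by blast
  let ?f = "\<lambda>k. if k \<le> e then g k else (case k - e of 0 \<Rightarrow> a | Suc j \<Rightarrow> h j)"
  have "colour_walk (e + Suc (m - Suc e)) p q ?f"
    using colour_walk_append[OF g colour_walk_Suc[OF h ab(1,3)]] by simp
  moreover have "?f e = a" "?f (Suc e) = b" using g h by (auto simp: colour_walk_def)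
  ultimately show ?thesis using ab(4) assms(4) by (intro exI[of _ ?f]) auto
qed

text \<open>For a colour \<open>d\<close> already present at \<open>T (2 * e)\<close>, beside the
  vertex that is to receive \<open>g e\<close>. At most one end of the walk is adjacent to position
  \<open>e\<close>, so only two colours have to be avoided.\<close>

lemma colour_walk_ex_avoid:
  assumes "p \<in> {1..3}" "q \<in> {1..3}" "4 \<le> m" "0 < e" "e < m"
  shows "\<exists>g. colour_walk m p q g \<and> g e \<noteq> d"
proof -
  obtain a where a: "a \<in> {1..3}" "a \<noteq> d" "e = 1 \<longrightarrow> a \<noteq> p" "m - e = 1 \<longrightarrow> a \<noteq> q"
  proof (cases "e = 1")
    case True
    then have "m - e \<noteq> 1" using assms(3) by simp
    then show ?thesis using colour_avoiding2[of d p] that by blast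
  next
    case False
    then show ?thesis using colour_avoiding2[of d q] that by blast
  qed
  have "2 \<le> e \<or> (e = 1 \<and> p \<noteq> a) \<or> (e = 0 \<and> p = a)"
    using a(3) assms(4) by (cases "e = 1") auto
  then obtain g where g: "colour_walk e p a g" using colour_walk_ex[OF assms(1) a(1), of e] by blast
  have "2 \<le> m - e \<or> (m - e = 1 \<and> a \<noteq> q) \<or> (m - e = 0 \<and> a = q)"
    using a(4) assms(5) by (cases "m - e = 1") auto
  then obtain h where h: "colour_walk (m - e) a q h" using colour_walk_ex[OF a(1) assms(2), of "m - e"] by blast
  show ?thesis using colour_walk_append[OF g h] g a assms by (auto simp: colour_walk_def intro!: exI[of _ "\<lambda>k. if k \<le> e then g k else h (k - e)"])
qed

text \<open>\<open>line_ok\<close> allows the colours that are harmless for every colour walk from \<open>i\<close> to \<open>j\<close>,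
  \<open>line_harmless\<close> those that are harmless for the colour walk \<open>g\<close>.\<close>

fun line_ok :: "nat \<Rightarrow> nat \<Rightarrow> nat \<Rightarrow> cell \<Rightarrow> nat option \<Rightarrow> bool" where
  "line_ok n i j (U l) s = (if l = 0 then s = Some i else if l = n + 1 then s = Some j else s = None)"
| "line_ok n i j (T l) s = (s = None \<or> (l = 2 \<and> s = Some i) \<or> (Suc l = n \<and> s = Some j))"
| "line_ok n i j (A l) s = (s = None \<or> (l = 1 \<and> s = Some i) \<or> (l = n \<and> s = Some j))"
| "line_ok n i j (B l) s = (s = None \<or> (l = 1 \<and> s = Some i) \<or> (l = n \<and> s = Some j))"

fun line_harmless :: "(nat \<Rightarrow> nat) \<Rightarrow> cell \<Rightarrow> nat option \<Rightarrow> bool" where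
  "line_harmless g (U l) s = False"
| "line_harmless g (T l) s = (even l \<and> s \<noteq> Some (g (l div 2)))"
| "line_harmless g (A l) s = (odd l \<longrightarrow> s \<noteq> Some (6 - g (l div 2) - g (Suc (l div 2))))"
| "line_harmless g (B l) s = (odd l \<longrightarrow> s \<noteq> Some (6 - g (l div 2) - g (Suc (l div 2))))"

section \<open>Forced wins on paths of even length\<close>

context game3
begin

text \<open>The colours tolerated by \<open>line_ok\<close> repeat an end colour close to that end.
  They obstruct no threat, since \<open>g 1\<close> differs from \<open>i\<close>,
  \<open>g (m - 1)\<close> differs from \<open>j\<close>, and the third colour of the first or last
  step differs from the end colour of that step.\<close>

lemma line_core:
  assumes sp: "weak_spine n w" and n: "n + 1 = 2 * m" "2 \<le> m" and g: "colour_walk m i j g"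
    and ok: "\<And>x. in_weak_window n x \<Longrightarrow> line_ok n i j x (c (w x)) \<or> line_harmless g x (c (w x))"
  shows "B_wins_moving c"
proof (rule alternating_line[OF sp n(1), of g])
  have g': "g 0 = i" "g m = j" "\<And>k. k \<le> m \<Longrightarrow> g k \<in> {1..3}" "\<And>k. k < m \<Longrightarrow> g k \<noteq> g (Suc k)"
    using g by (auto simp: colour_walk_def)
  have third: "6 - g k - g (Suc k) \<noteq> g k" "6 - g k - g (Suc k) \<noteq> g (Suc k)" if "k < m" for k
    using third_colour[of "g k" "g (Suc k)"] g'(3,4)[of k] g'(3)[of "Suc k"] that by auto
  show "1 \<le> m" using n by simp
  show "\<And>k. k \<le> m \<Longrightarrow> g k \<in> {1..3}" "\<And>k. k < m \<Longrightarrow> g k \<noteq> g (Suc k)" using g' by auto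
  show "c (w (U 0)) = Some (g 0)" using ok[of "U 0"] g' by simp
  show "c (w (U (2 * m))) = Some (g m)" using ok[of "U (2 * m)"] g' n by auto
  fix k assume k: "k < m"
  have kn: "2 * k + 1 \<le> n" using k n by linarith
  have AB: "s \<noteq> Some (6 - g k - g (Suc k))" if "line_ok n i j (A (2 * k + 1)) s \<or> line_harmless g (A (2 * k + 1)) s" for s
  proof -
    have "s = None \<or> k = 0 \<and> s = Some i \<or> Suc k = m \<and> s = Some j \<or> s \<noteq> Some (6 - g k - g (Suc k))"
      using that n by auto
    then show ?thesis using third[OF k] g' by auto
  qed
  show "c (w (U (2 * k + 1))) = None \<and> c (w (T (2 * k + 1))) = None \<and>
           c (w (A (2 * k + 1))) \<noteq> Some (6 - g k - g (Suc k)) \<and>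
           c (w (B (2 * k + 1))) \<noteq> Some (6 - g k - g (Suc k))"
  proof (intro conjI)
    show "c (w (U (2 * k + 1))) = None" using ok[of "U (2 * k + 1)"] kn by simp
    \<comment> \<open>As \<open>n\<close> is odd, the tolerated colours at \<open>T 2\<close> and
      \<open>T (n - 1)\<close> sit at even positions, away from the vertices where B executes
      threats.\<close>
    have "2 * k + 1 \<noteq> 2" "Suc (2 * k + 1) \<noteq> n" using n by presburger+
    then show "c (w (T (2 * k + 1))) = None" using ok[of "T (2 * k + 1)"] kn by simp
    show "c (w (A (2 * k + 1))) \<noteq> Some (6 - g k - g (Suc k))"
      using ok[of "A (2 * k + 1)"] kn by (intro AB) simp
    show "c (w (B (2 * k + 1))) \<noteq> Some (6 - g k - g (Suc k))"
      using ok[of "B (2 * k + 1)"] kn by (intro AB) simp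
  qed
next
  fix k assume k: "0 < k" "k < m"
  have g': "g 0 = i" "g m = j" "\<And>k. k < m \<Longrightarrow> g k \<noteq> g (Suc k)"
    using g by (auto simp: colour_walk_def)
  have kn: "2 * k \<le> n" "1 \<le> 2 * k" using k n by linarith+
  have "g 1 \<noteq> i" using g'(3)[of 0] g'(1) n by simp
  moreover have "g k \<noteq> j" if "Suc k = m" using g'(3)[of k] g'(2) that by auto
  ultimately show "c (w (U (2 * k))) = None \<and> c (w (T (2 * k))) \<noteq> Some (g k)"
    using ok[of "U (2 * k)"] ok[of "T (2 * k)"] kn n k by auto
qed

lemma even_line_w:
  assumes sp: "weak_spine n w" and n: "odd n" "3 \<le> n" and ij: "i \<in> {1..3}" "j \<in> {1..3}"
    and ok: "\<And>x. in_weak_window n x \<Longrightarrow> line_ok n i j x (c (w x))"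
  shows "B_wins_moving c"
proof -
  obtain m where m: "n + 1 = 2 * m" using n by (metis even_Suc even_two_times_div_two Suc_eq_plus1)
  obtain g where "colour_walk m i j g" using colour_walk_ex[OF ij, of m] m n by auto
  then show ?thesis using line_core[OF sp m _, of i j g c] ok m n by auto
qed

text \<open>The walk of colours is free between its ends, so it can be chosen around one stray
  colour beside the path. A colour on the path, or at an odd \<open>T l\<close> where a threat is
  executed, cannot be absorbed in this way. The bound 7 gives the walk its 4 steps.\<close>

lemma even_line_exception_w:
  assumes sp: "weak_spine n w" and n: "odd n" "7 \<le> n" and ij: "i \<in> {1..3}" "j \<in> {1..3}"
    and ok: "\<And>x. in_weak_window n x \<Longrightarrow> x \<noteq> e \<Longrightarrow> line_ok n i j x (c (w x))"
    and e: "\<And>l. e \<noteq> U l" "\<And>l. odd l \<Longrightarrow> e \<noteq> T l"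
  shows "B_wins_moving c"
proof -
  obtain m where m: "n + 1 = 2 * m" using n by (metis even_Suc even_two_times_div_two Suc_eq_plus1)
  have m4: "4 \<le> m" using m n by simp
  have "\<exists>g. colour_walk m i j g \<and> (in_weak_window n e \<longrightarrow> line_harmless g e (c (w e)))"
  proof (cases e)
    case (U l) then show ?thesis using e by simp
  next
    case (T l)
    show ?thesis
    proof (cases "in_weak_window n e")
      case True
      have "even l" using T e by auto
      then obtain g where "colour_walk m i j g" "g (l div 2) \<noteq> the (c (w e))"
        using colour_walk_ex_avoid[OF ij m4, of "l div 2" "the (c (w e))"] True T m by (auto elim!: evenE)
      then show ?thesis using \<open>even l\<close> T by (intro exI[of _ g]) auto
    next
      case False then show ?thesis using colour_walk_ex[OF ij, of m] m4 by auto
    qed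
  next
    case (A l)
    show ?thesis
    proof (cases "in_weak_window n e")
      case True
      then have "l div 2 < m" using A m by auto
      then obtain g where "colour_walk m i j g" "6 - g (l div 2) - g (Suc (l div 2)) \<noteq> the (c (w e))"
        using colour_walk_ex_step[OF ij m4, of "l div 2" "the (c (w e))"] by blast
      then show ?thesis using A by (intro exI[of _ g]) auto
    next
      case False then show ?thesis using colour_walk_ex[OF ij, of m] m4 by auto
    qed
  next
    case (B l)
    show ?thesis
    proof (cases "in_weak_window n e")
      case True
      then have "l div 2 < m" using B m by auto
      then obtain g where "colour_walk m i j g" "6 - g (l div 2) - g (Suc (l div 2)) \<noteq> the (c (w e))"
        using colour_walk_ex_step[OF ij m4, of "l div 2" "the (c (w e))"] by blast
      then show ?thesis using B by (intro exI[of _ g]) auto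
    next
      case False then show ?thesis using colour_walk_ex[OF ij, of m] m4 by auto
    qed
  qed
  then obtain g where g: "colour_walk m i j g" "in_weak_window n e \<Longrightarrow> line_harmless g e (c (w e))" by blast
  show ?thesis
  proof (rule line_core[OF sp m _ g(1)])
    show "2 \<le> m" using m4 by simp
    show "line_ok n i j x (c (w x)) \<or> line_harmless g x (c (w x))" if "in_weak_window n x" for x
      using ok[OF that] g(2) that by (cases "x = e") auto
  qed
qed

lemma even_line:
  assumes "spine n w" "odd n" "3 \<le> n" "i \<in> {1..3}" "j \<in> {1..3}"
    and "\<And>x. in_window n x \<Longrightarrow> line_ok n i j x (c (w x))"
  shows "B_wins_moving c"
  using assms weak_window_imp_window by (intro even_line_w[OF spine_imp_weak_spine[OF assms(1)] assms(2-5)]) auto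

lemma even_line_exception:
  assumes "spine n w" "odd n" "7 \<le> n" "i \<in> {1..3}" "j \<in> {1..3}"
    and "\<And>x. in_window n x \<Longrightarrow> x \<noteq> e \<Longrightarrow> line_ok n i j x (c (w x))"
    and "\<And>l. e \<noteq> U l" "\<And>l. odd l \<Longrightarrow> e \<noteq> T l"
  shows "B_wins_moving c"
  using assms weak_window_imp_window
  by (intro even_line_exception_w[OF spine_imp_weak_spine[OF assms(1)] assms(2-5), of e]) auto

end

text \<open>If \<open>A 1\<close> or \<open>B 1\<close> has the colour \<open>i\<close> of \<open>U 0\<close>, then this end of the window is protected: A cannot
  answer with colour \<open>i\<close> at \<open>T 1\<close>. The same holds at the other end.\<close>

fun clean :: "nat \<Rightarrow> nat \<Rightarrow> nat \<Rightarrow> cell \<Rightarrow> nat option \<Rightarrow> bool" where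
  "clean n i j (U l) s = (if l = 0 then s = Some i else if l = n + 1 then s = Some j else s = None)"
| "clean n i j (T l) s = (s = None)"
| "clean n i j (A l) s = (s = None \<or> (l = 1 \<and> s = Some i) \<or> (l = n \<and> s = Some j))"
| "clean n i j (B l) s = (s = None \<or> (l = 1 \<and> s = Some i) \<or> (l = n \<and> s = Some j))"

definition branch_clean :: "nat \<Rightarrow> nat \<Rightarrow> nat \<Rightarrow> cell \<Rightarrow> nat option \<Rightarrow> bool" where
  "branch_clean n i j x s = (if x = T 2 then s = Some i else clean n i j x s)"

lemma clean_imp_line_ok: "clean n i j x s \<Longrightarrow> line_ok n i j x s"
  by (cases x) auto

lemma branch_clean_imp_line_ok: "branch_clean n i j x s \<Longrightarrow> line_ok n i j x s"
  by (cases x) (auto simp: branch_clean_def split: if_splits)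

section \<open>Paths of odd length: repairing the parity\<close>

context game3
begin

lemma legal_spineD:
  assumes "spine n w" "legal_move V E 3 c v col"
  shows "c v = None" "v \<in> V" "col \<in> {1..3}" "v = w x \<Longrightarrow> inner n x \<Longrightarrow> y \<in> cell_nb x \<Longrightarrow> c (w y) \<noteq> Some col"
  using assms spineD(3)[OF assms(1)] by (auto simp: legal_move_def nbr_colours_nb)

lemma threat_cells:
  assumes sp: "spine n w" and "inner n y" "inner n z" "y \<noteq> z" "cell_nb y = {p, q, z}"
    and "d (w y) = None" "d (w z) = None"
    and "d (w p) = Some i" "d (w q) = Some j" "i \<noteq> j" "i \<in> {1..3}" "j \<in> {1..3}"
    and "\<And>u. u \<in> cell_nb z \<Longrightarrow> d (w u) \<noteq> Some (6 - i - j)"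
  shows "B_wins_moving d"
  using assms spineD[OF sp] inner_imp_window
  by (intro threat[of "w y" "w z" "w p" "w q" d i j]) (auto simp del: One_nat_def)

text \<open>\<open>U 0\<close> and \<open>T 2\<close> have the same colour and distance 3, so one of them has even distance to any third
  coloured vertex on the path. The excluded moves are the ones that spoil both lines.\<close>

lemma branch_clean_reply:
  assumes sp: "spine n w" and n: "8 \<le> n" and ij: "i \<in> {1..3}" "j \<in> {1..3}"
    and st: "\<And>x. in_window n x \<Longrightarrow> branch_clean n i j x (c (w x))"
    and lg: "legal_move V E 3 c v col"
    and esc: "\<not> (v = w (T n) \<and> col = j)"
       "odd n \<Longrightarrow> \<not> (v = w (T 1) \<and> col = i)" "odd n \<Longrightarrow> \<not> (v = w (U 3) \<and> col = i)"
  shows "B_wins_moving (c(v := Some col))"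
proof -
  define d where "d = c(v := Some col)"
  have col: "col \<in> {1..3}" using legal_spineD[OF sp lg] by simp
  have third_i: "6 - i - col \<noteq> i" "6 - col - i \<noteq> i" if "col \<noteq> i"
    using third_colour[of i col] third_colour[of col i] that ij col by auto
  have cU: "c (w (U l)) = (if l = 0 then Some i else if l = n + 1 then Some j else None)" if "l \<le> n + 1" for l
    using st[of "U l"] that by (auto simp: branch_clean_def)
  have cT: "c (w (T l)) = (if l = 2 then Some i else None)" if "1 \<le> l" "l \<le> n" for l
    using st[of "T l"] that by (auto simp: branch_clean_def)
  have cA: "c (w (A l)) = None \<or> (l = 1 \<and> c (w (A l)) = Some i) \<or> (l = n \<and> c (w (A l)) = Some j)"
    if "1 \<le> l" "l \<le> n" for l
    using st[of "A l"] that by (auto simp: branch_clean_def)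
  have cB: "c (w (B l)) = None \<or> (l = 1 \<and> c (w (B l)) = Some i) \<or> (l = n \<and> c (w (B l)) = Some j)"
    if "1 \<le> l" "l \<le> n" for l
    using st[of "B l"] that by (auto simp: branch_clean_def)
  \<comment> \<open>On the line that starts at \<open>T 2\<close> the old end \<open>U 0\<close> is
    the leaf \<open>A 1\<close>, where its colour \<open>i\<close> is tolerated.\<close>
  have okl: "line_ok (n - 1) i j y (c (w (branch_cell y)))" if "in_window (n - 1) y" for y
  proof (cases y)
    case (U k)
    then show ?thesis using that n by (auto simp: cU cT split: if_splits)
  next
    case (T k)
    then have "k + 1 \<le> n" using that n by auto
    then show ?thesis using T that n cT[of "k + 1"] by (auto simp: cU cT split: if_splits)
  next
    case (A k)
    then have "k + 1 \<le> n" using that n by auto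
    then show ?thesis using A that n cA[of "k + 1"] by (auto simp: cU cT split: if_splits)
  next
    case (B k)
    then have "k + 1 \<le> n" using that n by auto
    then show ?thesis using B that n cB[of "k + 1"] by (auto simp: cU cT split: if_splits)
  qed
  have "B_wins_moving d"
  proof (cases "v \<in> w ` {x. in_window n x}")
    case False
    then have d: "d (w y) = c (w y)" if "in_window n y" for y using that by (auto simp: d_def)
    show ?thesis
    proof (cases "odd n")
      case True
      then show ?thesis
        using st n by (intro even_line[OF sp _ _ ij]) (auto simp: d branch_clean_imp_line_ok)
    next
      case False
      show ?thesis
      proof (rule even_line[OF spine_branch[OF sp] _ _ ij])
        show "line_ok (n - 1) i j y (d ((w \<circ> branch_cell) y))" if y: "in_window (n - 1) y" for y
        proof -
          have "in_window n (branch_cell y)" using y n by (cases y) auto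
          then show ?thesis using okl[OF y] d by simp
        qed
      qed ((use False n in presburger)+)
    qed
  next
    case True
    then obtain x where x: "v = w x" "in_window n x" by auto
    have d: "d (w y) = (if y = x then Some col else c (w y))" if "in_window n y" for y
      unfolding d_def x(1) using spine_upd[OF sp x(2) that, of c "Some col"] .
    have cx: "c (w x) = None" using legal_spineD(1)[OF sp lg] x by simp
    have legx: "c (w y) \<noteq> Some col" if "inner n x" "y \<in> cell_nb x" for y
      using legal_spineD(4)[OF sp lg x(1)] that by auto
    have xT2: "x \<noteq> T 2" using cx cT[of 2] n by auto
    \<comment> \<open>A colour beside the path is absorbed by whichever of the two lines is even:
      the one from \<open>U 0\<close> for odd \<open>n\<close>, the one from \<open>T 2\<close> for
      even \<open>n\<close>. Passing to the second line shifts positions by one, hence the opposite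
      parity conditions.\<close>
    have exc: "B_wins_moving d" if "\<And>l. x \<noteq> U l" "even n \<Longrightarrow> (\<exists>l. x = A l \<or> x = B l \<or> (odd l \<and> x = T l))"
       "odd n \<Longrightarrow> (\<exists>l. x = A l \<or> x = B l \<or> (even l \<and> x = T l))"
    proof (cases "odd n")
      case True
      show ?thesis
        by (rule even_line_exception[OF sp True _ ij, of x])
          (use that True n in \<open>auto simp: d branch_clean_imp_line_ok st\<close>)
    next
      case False
      \<comment> \<open>The cell \<open>x\<close> in the labels of the line from \<open>T 2\<close>,
        where \<open>T 1\<close> is the leaf \<open>B 1\<close>.\<close>
      define e where "e = (case x of A l \<Rightarrow> A (l - 1) | B l \<Rightarrow> B (l - 1) | T l \<Rightarrow> (if l = 1 then B 1 else T (l - 1)) | U l \<Rightarrow> U l)"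
      have e1: "branch_cell y = x \<Longrightarrow> in_window (n - 1) y \<Longrightarrow> y = e" for y
        using that(1) xT2 by (cases y) (auto simp: e_def split: if_splits)
      show ?thesis
      proof (rule even_line_exception[OF spine_branch[OF sp] _ _ ij, of e])
        show "line_ok (n - 1) i j y (d ((w \<circ> branch_cell) y))" if y: "in_window (n - 1) y" "y \<noteq> e" for y
        proof -
          have "in_window n (branch_cell y)" using y n by (cases y) auto
          then show ?thesis using okl[OF y(1)] d e1[of y] y by auto
        qed
        show "e \<noteq> U l" for l using that(1) by (cases x) (auto simp: e_def)
        show "e \<noteq> T l" if "odd l" for l
          using \<open>odd l\<close> that False x(2) \<open>even n \<Longrightarrow> (\<exists>l. x = A l \<or> x = B l \<or> (odd l \<and> x = T l))\<close> by (auto simp: e_def split: if_splits)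
      qed ((use False n in presburger)+)
    qed
    show ?thesis
    proof (cases x)
      case (A l) then show ?thesis using exc by auto
    next
      case (B l) then show ?thesis using exc by auto
    next
      case (T l)
      note xl = T
      from xl have l: "1 \<le> l" "l \<le> n" using x by auto
      have l2: "l \<noteq> 2" using cx cT[OF l] T by auto
      show ?thesis
      proof (cases "odd l = odd n")
        case False
        then show ?thesis using exc T by auto
      next
        case par: True
        show ?thesis
        proof (cases "l = n")
          case True
          then have "col \<noteq> j" using esc(1) x T by auto
          \<comment> \<open>Since \<open>col\<close> is not \<open>j\<close>, the vertex
            \<open>U n\<close> has two differently coloured neighbours and B blocks it from
            \<open>U (n - 1)\<close>.\<close>
          then show ?thesis using n ij col T True cT[of "n - 1"]
            by (intro threat_cells[OF sp, of "U n" "U (n - 1)" "T n" "U (n + 1)" d col j])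
              (auto simp: d cU cT split: if_splits)
        next
          case ln: False
          show ?thesis
          proof (cases "odd n")
            case True
            have odd: "odd l" "l < n - 1" using True par ln l by presburger+
            show ?thesis
            proof (cases "l = 1")
              case l1: True
              then have "col \<noteq> i" using esc(2) True x T by auto
              then show ?thesis using n ij col T l1 third_i
                by (intro threat_cells[OF sp, of "U 1" "U 2" "U 0" "T 1" d i col])
                  (auto simp: d cU cT numeral_2_eq_2)
            next
              case False
              show ?thesis
              proof (rule even_line[OF spine_bend[OF sp] odd(1) _ ij(1) col])
                show "line_ok l i col y (d ((w \<circ> bend_cell l) y))" if "in_window l y" for y
                proof (cases y)
                  case (U k)
                  then show ?thesis using that odd l xl n by (auto simp: bend_cell_def d cU cT split: if_splits)
                next
                  case (T k)
                  then have "k \<le> n" using that odd l xl n by auto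
                  then show ?thesis using T that odd l xl n cT[of "k"] by (auto simp: bend_cell_def d cU cT split: if_splits)
                next
                  case (A k)
                  then have "k \<le> n" using that odd l xl n by auto
                  then show ?thesis using A that odd l xl n cA[of "k"] by (auto simp: bend_cell_def d cU cT split: if_splits)
                next
                  case (B k)
                  then have "k \<le> n" using that odd l xl n by auto
                  then show ?thesis using B that odd l xl n cB[of "k"] by (auto simp: bend_cell_def d cU cT split: if_splits)
                qed
              qed ((use odd l False in presburger)+)
            qed
          next
            case False
            have ev: "even l" "l < n - 1" "4 \<le> l" using False par ln l l2 by presburger+
            show ?thesis
            proof (rule even_line[OF spine_bend[OF spine_branch[OF sp]] _ _ ij(1) col])
              show "line_ok (l - 1) i col y (d ((w \<circ> branch_cell \<circ> bend_cell (l - 1)) y))" if "in_window (l - 1) y" for y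
              proof (cases y)
                case (U k)
                then show ?thesis using that ev l xl n by (auto simp: bend_cell_def d cU cT split: if_splits)
              next
                case (T k)
                then have "k + 1 \<le> n" using that ev l xl n by auto
                then show ?thesis using T that ev l xl n cT[of "k + 1"] by (auto simp: bend_cell_def d cU cT split: if_splits)
              next
                case (A k)
                then have "k + 1 \<le> n" using that ev l xl n by auto
                then show ?thesis using A that ev l xl n cA[of "k + 1"] by (auto simp: bend_cell_def d cU cT split: if_splits)
              next
                case (B k)
                then have "k + 1 \<le> n" using that ev l xl n by auto
                then show ?thesis using B that ev l xl n cB[of "k + 1"] by (auto simp: bend_cell_def d cU cT split: if_splits)
              qed
            qed ((use ev n in presburger)+)
          qed
        qed
      qed
    next
      case (U l)
      note xl = U
      from xl have l: "1 \<le> l" "l \<le> n" using x cx cU[of l] by (auto split: if_splits)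
      show ?thesis
      \<comment> \<open>Close to the two copies of \<open>i\<close>, a colour on the path gives
        \<open>U 1\<close> or \<open>U 2\<close> two differently coloured neighbours; the only
        exception is \<open>i\<close> at \<open>U 3\<close>.\<close>
      proof (cases "l \<le> 3")
        case True
        then consider "l = 1" | "l = 2" | "l = 3" "col \<noteq> i" | "l = 3" "col = i" using l by linarith
        then show ?thesis
        proof cases
          case 1
          then have "col \<noteq> i" using legx[of "U 0"] U cU[of 0] n by auto
          then show ?thesis using n ij col U 1
            by (intro threat_cells[OF sp, of "U 2" "U 3" "T 2" "U 1" d i col])
              (auto simp: d cU cT numeral_eq_Suc)
        next
          case 2
          then have "col \<noteq> i" using legx[of "T 2"] U cT[of 2] n by auto
          then show ?thesis using n ij col U 2 third_i cA[of 1] cB[of 1]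
            by (intro threat_cells[OF sp, of "U 1" "T 1" "U 0" "U 2" d i col])
              (auto simp: d cU cT numeral_eq_Suc)
        next
          case 3
          then show ?thesis using n ij col U third_i
            by (intro threat_cells[OF sp, of "U 2" "U 1" "T 2" "U 3" d i col])
              (auto simp: d cU cT numeral_eq_Suc)
        next
          case 4
          then have "even n" using esc(3) x U by auto
          show ?thesis
          proof (rule even_line[OF spine_shift[OF sp, of 3] _ _ ij])
            show "line_ok (n - 3) i j y (d ((w \<circ> shift_cell 3) y))" if "in_window (n - 3) y" for y
            proof (cases y)
              case (U k)
              then show ?thesis using that n xl 4 by (auto simp: d cU cT split: if_splits)
            next
              case (T k)
              then have "k + 3 \<le> n" using that n xl 4 by auto
              then show ?thesis using T that n xl 4 cT[of "k + 3"] by (auto simp: d cU cT split: if_splits)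
            next
              case (A k)
              then have "k + 3 \<le> n" using that n xl 4 by auto
              then show ?thesis using A that n xl 4 cA[of "k + 3"] by (auto simp: d cU cT split: if_splits)
            next
              case (B k)
              then have "k + 3 \<le> n" using that n xl 4 by auto
              then show ?thesis using B that n xl 4 cB[of "k + 3"] by (auto simp: d cU cT split: if_splits)
            qed
          qed ((use \<open>even n\<close> n in presburger)+)
        qed
      next
        case False
        show ?thesis
        \<comment> \<open>The new colour has distance \<open>l\<close> from \<open>U 0\<close> and
          \<open>l - 1\<close> from \<open>T 2\<close>; B uses the even one.\<close>
        proof (cases "even l")
          case True
          show ?thesis
          proof (rule even_line[OF spine_cut[OF sp, of "l - 1"] _ _ ij(1) col])
            show "line_ok (l - 1) i col y (d (w y))" if "in_window (l - 1) y" for y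
            proof (cases y)
              case (U k)
              then show ?thesis using that n xl l False by (auto simp: d cU cT split: if_splits)
            next
              case (T k)
              then have "k \<le> n" using that n xl l False by auto
              then show ?thesis using T that n xl l False cT[of "k"] by (auto simp: d cU cT split: if_splits)
            next
              case (A k)
              then have "k \<le> n" using that n xl l False by auto
              then show ?thesis using A that n xl l False cA[of "k"] by (auto simp: d cU cT split: if_splits)
            next
              case (B k)
              then have "k \<le> n" using that n xl l False by auto
              then show ?thesis using B that n xl l False cB[of "k"] by (auto simp: d cU cT split: if_splits)
            qed
          qed ((use True False l in presburger)+)
        next
          case odd: False
          show ?thesis
          proof (rule even_line[OF spine_cut[OF spine_branch[OF sp], of "l - 2"] _ _ ij(1) col])
            show "line_ok (l - 2) i col y (d ((w \<circ> branch_cell) y))" if "in_window (l - 2) y" for y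
            proof (cases y)
              case (U k)
              then show ?thesis using that n xl l False by (auto simp: d cU cT split: if_splits)
            next
              case (T k)
              then have "k + 1 \<le> n" using that n xl l False by auto
              then show ?thesis using T that n xl l False cT[of "k + 1"] by (auto simp: d cU cT split: if_splits)
            next
              case (A k)
              then have "k + 1 \<le> n" using that n xl l False by auto
              then show ?thesis using A that n xl l False cA[of "k + 1"] by (auto simp: d cU cT split: if_splits)
            next
              case (B k)
              then have "k + 1 \<le> n" using that n xl l False by auto
              then show ?thesis using B that n xl l False cB[of "k + 1"] by (auto simp: d cU cT split: if_splits)
            qed
          qed ((use odd False l n in presburger)+)
        qed
      qed
    qed
  qed
  then show ?thesis by (simp add: d_def)
qed

lemma cell_move:
  assumes "spine n w" "inner n x" "c (w x) = None" "k \<in> {1..3}" "\<And>y. y \<in> cell_nb x \<Longrightarrow> c (w y) \<noteq> Some k"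
  shows "legal_move V E 3 c (w x) k"
  using assms spineD[OF assms(1)] inner_imp_window[OF assms(2)] by (auto simp: legal_move_def nbr_colours_nb)

lemma branch_clean_waiting:
  assumes sp: "spine n w" and n: "8 \<le> n" and ij: "i \<in> {1..3}" "j \<in> {1..3}"
    and st: "\<And>x. in_window n x \<Longrightarrow> branch_clean n i j x (c (w x))"
    and esc: "legal_move V E 3 c (w (T n)) j \<Longrightarrow> B_wins_moving (c(w (T n) := Some j))"
      "odd n \<Longrightarrow> legal_move V E 3 c (w (T 1)) i \<Longrightarrow> B_wins_moving (c(w (T 1) := Some i))"
      "odd n \<Longrightarrow> legal_move V E 3 c (w (U 3)) i \<Longrightarrow> B_wins_moving (c(w (U 3) := Some i))"
  shows "B_wins_waiting c"
proof (rule not_A_wins_A_move)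
  show "w (U 1) \<in> V" using spineD(1)[OF sp, of "U 1"] by simp
  show "c (w (U 1)) = None" using st[of "U 1"] n by (simp add: branch_clean_def)
  fix v col assume lg: "legal_move V E 3 c v col"
  show "B_wins_moving (c(v := Some col))"
    using esc branch_clean_reply[OF sp n ij st lg] lg by blast
qed

text \<open>B plants \<open>i\<close> at \<open>T 2\<close>. For even \<open>n\<close> the only
  escape left to A would be \<open>j\<close> at \<open>T n\<close>, and the protection makes that
  move illegal.\<close>

lemma even_window_protected:
  assumes sp: "spine n w" and n: "8 \<le> n" "even n" and ij: "i \<in> {1..3}" "j \<in> {1..3}"
    and st: "\<And>x. in_window n x \<Longrightarrow> clean n i j x (c (w x))"
    and prot: "c (w (A n)) = Some j \<or> c (w (B n)) = Some j"
  shows "B_wins_moving c"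
proof (rule not_A_wins_B_move)
  show "legal_move V E 3 c (w (T 2)) i"
    using st[of "U 2"] st[of "T 2"] st[of "A 2"] st[of "B 2"] n ij
    by (intro cell_move[OF sp]) (auto split: if_splits)
  have upd: "(c(w (T 2) := Some i)) (w y) = (if y = T 2 then Some i else c (w y))" if "in_window n y" for y
    using spine_upd[OF sp _ that, of "T 2" c "Some i"] n by simp
  show "B_wins_waiting (c(w (T 2) := Some i))"
  proof (rule branch_clean_waiting[OF sp n(1) ij])
    show "branch_clean n i j x ((c(w (T 2) := Some i)) (w x))" if "in_window n x" for x
      using st[OF that] upd[OF that] by (simp add: branch_clean_def)
    assume lg: "legal_move V E 3 (c(w (T 2) := Some i)) (w (T n)) j"
    have "(c(w (T 2) := Some i)) (w (A n)) \<noteq> Some j" "(c(w (T 2) := Some i)) (w (B n)) \<noteq> Some j"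
      using legal_spineD(4)[OF sp lg, of "T n"] n by auto
    then show "B_wins_moving ((c(w (T 2) := Some i))(w (T n) := Some j))"
      using prot upd[of "A n"] upd[of "B n"] n by auto
  qed (use n in auto)
qed

text \<open>After \<open>i\<close> at \<open>T 2\<close> only \<open>j\<close> at the last branch
  vertex escapes. B repeats \<open>j\<close> on the branch before it and bends the path into that
  branch. The new window has odd length \<open>k\<close>, and the two older copies of
  \<open>j\<close> are its last leaves, so its right end is protected. The two escapes at the left
  end are left, and each of them leads to a protected window of even length. The bound 11 makes the
  shortest of these, \<open>k - 3\<close>, at least 8.\<close>

lemma even_window:
  assumes sp: "spine (Suc k) w" and n: "11 \<le> k" "odd k" and ij: "i \<in> {1..3}" "j \<in> {1..3}"
    and st: "\<And>x. in_window (Suc k) x \<Longrightarrow> clean (Suc k) i j x (c (w x))"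
  shows "B_wins_moving c"
proof -
  have cU: "c (w (U l)) = (if l = 0 then Some i else if l = Suc k + 1 then Some j else None)" if "l \<le> Suc k + 1" for l
    using st[of "U l"] that by auto
  have cT: "c (w (T l)) = None" if "1 \<le> l" "l \<le> Suc k" for l
    using st[of "T l"] that by auto
  have cA: "c (w (A l)) = None \<or> (l = 1 \<and> c (w (A l)) = Some i) \<or> (l = Suc k \<and> c (w (A l)) = Some j)"
    if "1 \<le> l" "l \<le> Suc k" for l
    using st[of "A l"] that by auto
  have cB: "c (w (B l)) = None \<or> (l = 1 \<and> c (w (B l)) = Some i) \<or> (l = Suc k \<and> c (w (B l)) = Some j)"
    if "1 \<le> l" "l \<le> Suc k" for l
    using st[of "B l"] that by auto
  define c1 where "c1 = c(w (T 2) := Some i)"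
  have u1: "c1 (w y) = (if y = T 2 then Some i else c (w y))" if "in_window (Suc k) y" for y
    unfolding c1_def using spine_upd[OF sp _ that, of "T 2" c "Some i"] n by simp
  have lg1: "legal_move V E 3 c (w (T 2)) i"
    using cA[of 2] cB[of 2] n ij by (intro cell_move[OF sp]) (auto simp: cU cT)
  have "B_wins_waiting c1"
  proof (rule branch_clean_waiting[OF sp _ ij])
    show "branch_clean (Suc k) i j x (c1 (w x))" if "in_window (Suc k) x" for x
      using st[OF that] u1[OF that] by (simp add: branch_clean_def)
    define c2 where "c2 = c1(w (T (Suc k)) := Some j)"
    have u2: "c2 (w y) = (if y = T (Suc k) then Some j else if y = T 2 then Some i else c (w y))" if "in_window (Suc k) y" for y
      unfolding c2_def using spine_upd[OF sp _ that, of "T (Suc k)" c1 "Some j"] n u1[OF that] by simp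
    define c3 where "c3 = c2(w (T k) := Some j)"
    have u3: "c3 (w y) = (if y = T k \<or> y = T (Suc k) then Some j else if y = T 2 then Some i else c (w y))" if "in_window (Suc k) y" for y
    proof -
      have "in_window (Suc k) (T k)" using n by auto
      from spine_upd[OF sp this that, of c2 "Some j"] show ?thesis unfolding c3_def using u2[OF that] by auto
    qed
    have lg3: "legal_move V E 3 c2 (w (T k)) j"
      using cA[of "k"] cB[of "k"] n ij by (intro cell_move[OF sp]) (auto simp: u2 cU cT)
    \<comment> \<open>The path now ends in \<open>T k\<close>; \<open>U (k + 2)\<close> and
      \<open>T (k + 1)\<close>, both coloured \<open>j\<close>, are the leaves at its last
      branch.\<close>
    define w1 where "w1 = w \<circ> bend_cell k"
    have sp1: "spine k w1" unfolding w1_def using n by (intro spine_bend[OF sp]) auto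
    have ends: "w1 (U (Suc k)) = w (T k)" "w1 (T k) = w (U (Suc k))" "w1 (A k) = w (U (Suc k + 1))"
      "w1 (B k) = w (T (Suc k))"
      using n by (auto simp: w1_def bend_cell_def numeral_2_eq_2)
    have same: "w1 y = w y" if "in_window k y" "y \<noteq> U (Suc k)" "y \<noteq> T k" "y \<noteq> A k" "y \<noteq> B k" for y
      using that n by (auto simp: w1_def bend_cell_def)
    have st1: "branch_clean k i j x (c3 (w1 x))" if x: "in_window k x" for x
    proof (cases "x = U (Suc k) \<or> x = T k \<or> x = A k \<or> x = B k")
      case True
      then show ?thesis using ends n cU cT by (auto simp: u3 branch_clean_def)
    next
      case False
      then have "w1 x = w x" "in_window (Suc k) x" using same x by (cases x; auto)+
      then show ?thesis using u3[of x] st[of x] False x n by (cases x) (auto simp: branch_clean_def)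
    qed
    have "B_wins_waiting c3"
    proof (rule branch_clean_waiting[OF sp1 _ ij st1])
      assume "legal_move V E 3 c3 (w1 (T k)) j"
      then have "c3 (w (U (Suc k + 1))) \<noteq> Some j"
        using legal_spineD(4)[OF sp1, of c3 "w1 (T k)" j "T k" "A k"] n ends by auto
      then show "B_wins_moving (c3(w1 (T k) := Some j))" using u3[of "U (Suc k + 1)"] cU[of "Suc k + 1"] by simp
    next
      have u4: "(c3(w1 x := Some q)) (w1 y) = (if y = x then Some q else c3 (w1 y))"
        if "in_window k x" "in_window k y" for x y q
        using spine_upd[OF sp1 that, of c3 "Some q"] .
      have protA: "c3 (w1 (A k)) = Some j" using ends u3[of "U (Suc k + 1)"] cU[of "Suc k + 1"] by simp
      \<comment> \<open>The path from \<open>T 2\<close> has even window length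
        \<open>k - 1\<close>; \<open>U 0\<close> and \<open>T 1\<close> carry the tolerated colour
        \<open>i\<close> as its first leaves.\<close>
      show "B_wins_moving (c3(w1 (T 1) := Some i))"
      proof (rule even_window_protected[OF spine_branch[OF sp1] _ _ ij])
        show "clean (k - 1) i j x ((c3(w1 (T 1) := Some i)) ((w1 \<circ> branch_cell) x))" if x: "in_window (k - 1) x" for x
        proof -
          have "in_window k (branch_cell x)" using x n by (cases x) auto
          then show ?thesis using st1[of "branch_cell x"] u4[of "T 1" "branch_cell x" i] x n
            by (cases x) (auto simp: branch_clean_def split: if_splits)
        qed
        show "(c3(w1 (T 1) := Some i)) ((w1 \<circ> branch_cell) (A (k - 1))) = Some j \<or>
              (c3(w1 (T 1) := Some i)) ((w1 \<circ> branch_cell) (B (k - 1))) = Some j"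
          using n protA u4[of "T 1" "A k" i] by (auto simp: Suc_diff_le)
      qed (use n in auto)
      \<comment> \<open>The path from \<open>U 3\<close> has even window length \<open>k - 3\<close>
        and leaves the planted colour at \<open>T 2\<close> outside the window.\<close>
      show "B_wins_moving (c3(w1 (U 3) := Some i))"
      proof (rule even_window_protected[OF spine_shift[OF sp1, of 3] _ _ ij])
        show "clean (k - 3) i j x ((c3(w1 (U 3) := Some i)) ((w1 \<circ> shift_cell 3) x))" if x: "in_window (k - 3) x" for x
        proof -
          have "in_window k (shift_cell 3 x)" using x n by (cases x) auto
          then show ?thesis using st1[of "shift_cell 3 x"] u4[of "U 3" "shift_cell 3 x" i] x n
            by (cases x) (auto simp: branch_clean_def numeral_3_eq_3 split: if_splits)
        qed
        have "(w1 \<circ> shift_cell 3) (A (k - 3)) = w1 (A k)" using n by simp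
        then show "(c3(w1 (U 3) := Some i)) ((w1 \<circ> shift_cell 3) (A (k - 3))) = Some j \<or>
              (c3(w1 (U 3) := Some i)) ((w1 \<circ> shift_cell 3) (B (k - 3))) = Some j"
          using n protA u4[of "U 3" "A k" i] by auto
      qed (use n in auto)
    qed (use n in auto)
    then have "B_wins_moving c2" using not_A_wins_B_move[OF lg3] by (simp add: c3_def)
    then show "B_wins_moving (c1(w (T (Suc k)) := Some j))" by (simp add: c2_def)
  qed (use n in auto)
  then show ?thesis using not_A_wins_B_move[OF lg1] by (simp add: c1_def)
qed

text \<open>From here on, parity is irrelevant in a clean window as long as B is to move. What
  remains is to handle positions in which A moves.\<close>

lemma clean_window:
  assumes sp: "spine n w" and n: "12 \<le> n" and ij: "i \<in> {1..3}" "j \<in> {1..3}"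
    and st: "\<And>x. in_window n x \<Longrightarrow> clean n i j x (c (w x))"
  shows "B_wins_moving c"
proof (cases "odd n")
  case True
  then show ?thesis using n st by (intro even_line[OF sp _ _ ij]) (auto simp: clean_imp_line_ok)
next
  case False
  then obtain k where "n = Suc k" using n by (cases n) auto
  then show ?thesis using even_window[of k w i j c] False n sp ij st by auto
qed

end

section \<open>B's answers to a move of A in a clean window\<close>

fun swap_cell :: "cell \<Rightarrow> cell" where
  "swap_cell (U l) = U l" | "swap_cell (T l) = T l" | "swap_cell (A l) = B l" | "swap_cell (B l) = A l"

context game3
begin

lemma spine_swap: "spine n w \<Longrightarrow> spine n (w \<circ> swap_cell)"
proof (rule spine_map, assumption)
  show "inj_on swap_cell {x. in_window n x}"
    by (rule inj_onI) (auto elim!: swap_cell.elims)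
qed (auto elim!: in_window.elims inner.elims)

lemma clean_mirror:
  assumes "\<And>x. in_window n x \<Longrightarrow> clean n i j x (c (w x))" "2 \<le> n" "in_window n x"
  shows "clean n j i x (c ((w \<circ> mirror_cell n) x))"
proof -
  have "in_window n (mirror_cell n x)" using assms(3) by (cases x) auto
  moreover have "Suc n - k = Suc 0 \<longleftrightarrow> k = n" "Suc n - k = n \<longleftrightarrow> k = 1" if "1 \<le> k" "k \<le> n" for k
    using that by auto
  ultimately show ?thesis
    using assms(1)[of "mirror_cell n x"] assms(2,3) by (cases x) (auto split: if_splits)
qed

text \<open>A's vertex cuts the path, and since 25 = 12 + 1 + 12 at least one side is a clean window
  of length 12 or more.\<close>

lemma reply_path:
  assumes sp: "spine n w" and n: "25 \<le> n" and ij: "i \<in> {1..3}" "j \<in> {1..3}" "col \<in> {1..3}"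
    and st: "\<And>x. in_window n x \<Longrightarrow> clean n i j x (c (w x))"
    and l: "1 \<le> l" "l \<le> n"
  shows "B_wins_moving (c(w (U l) := Some col))"
proof (cases "13 \<le> l")
  case True
  show ?thesis
  proof (rule clean_window[OF spine_cut[OF sp, of "l - 1"] _ ij(1,3)])
    show "clean (l - 1) i col x ((c(w (U l) := Some col)) (w x))" if "in_window (l - 1) x" for x
    proof -
      have "in_window n x" using that l by (cases x) auto
      then show ?thesis using st[of x] that l spine_upd[OF sp, of "U l" x c "Some col"] by (cases x) auto
    qed
  qed (use True l in auto)
next
  case False
  show ?thesis
  proof (rule clean_window[OF spine_shift[OF sp, of l] _ ij(3,2)])
    show "clean (n - l) col j x ((c(w (U l) := Some col)) ((w \<circ> shift_cell l) x))" if "in_window (n - l) x" for x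
    proof -
      have "in_window n (shift_cell l x)" using that l by (cases x) auto
      then show ?thesis using st[of "shift_cell l x"] that l spine_upd[OF sp, of "U l" "shift_cell l x" c "Some col"] by (cases x) auto
    qed
  qed (use False l n in auto)
qed

text \<open>\<open>U 1\<close> then has the differently coloured neighbours \<open>U 0\<close> and
  \<open>T 1\<close>, and B blocks it from \<open>U 2\<close>. Only the colour \<open>i\<close>
  avoids this.\<close>

lemma reply_sibling:
  assumes sp: "spine n w" and n: "4 \<le> n" and ij: "i \<in> {1..3}" "col \<in> {1..3}" "col \<noteq> i"
    and st: "\<And>x. in_window n x \<Longrightarrow> clean n i j x (c (w x))"
  shows "B_wins_moving (c(w (T 1) := Some col))"
proof -
  have d: "(c(w (T 1) := Some col)) (w x) = (if x = T 1 then Some col else c (w x))" if "in_window n x" for x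
    using spine_upd[OF sp, of "T 1" x c "Some col"] that n by simp
  show ?thesis
    using n ij st[of "U 0"] st[of "U 1"] st[of "U 2"] st[of "U 3"] st[of "T 2"]
      d[of "U 0"] d[of "U 1"] d[of "U 2"] d[of "U 3"] d[of "T 2"] d[of "T 1"]
    by (intro threat_cells[OF sp, of "U 1" "U 2" "U 0" "T 1" _ i col]) (auto simp: numeral_eq_Suc)
qed

lemma reply_sibling_right:
  assumes sp: "spine n w" and n: "4 \<le> n" and ij: "j \<in> {1..3}" "col \<in> {1..3}" "col \<noteq> j"
    and st: "\<And>x. in_window n x \<Longrightarrow> clean n i j x (c (w x))"
  shows "B_wins_moving (c(w (T n) := Some col))"
proof -
  have "B_wins_moving (c((w \<circ> mirror_cell n) (T 1) := Some col))"
  proof (rule reply_sibling[OF spine_mirror[OF sp] n ij])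
    show "clean n j i x (c ((w \<circ> mirror_cell n) x))" if "in_window n x" for x
      using n that st by (intro clean_mirror[of n i j c w]) auto
  qed
  then show ?thesis using n by simp
qed

text \<open>The path from \<open>U 0\<close> into the branch ends at A's new colour and has even
  length \<open>l + 1\<close>. For \<open>l = n - 1\<close> the coloured end
  \<open>U (n + 1)\<close> becomes a leaf of that line and is absorbed as its single
  exception.\<close>

lemma reply_branch:
  assumes sp: "spine n w" and n: "8 \<le> n" and ij: "i \<in> {1..3}" "j \<in> {1..3}" "col \<in> {1..3}"
    and st: "\<And>x. in_window n x \<Longrightarrow> clean n i j x (c (w x))"
    and l: "3 \<le> l" "l < n" "odd l"
  shows "B_wins_moving (c(w (T l) := Some col))"
proof -
  have d: "(c(w (T l) := Some col)) (w x) = (if x = T l then Some col else c (w x))" if "in_window n x" for x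
    using spine_upd[OF sp, of "T l" x c "Some col"] that l by simp
  have ok: "line_ok l i col x ((c(w (T l) := Some col)) ((w \<circ> bend_cell l) x))"
    if x: "in_window l x" "l + 1 < n \<or> x \<noteq> A l" for x
  proof -
    have "in_window n (bend_cell l x)" using x l by (cases x) (auto simp: bend_cell_def)
    then show ?thesis using st[of "bend_cell l x"] d[of "bend_cell l x"] x l
      by (cases x) (auto simp: bend_cell_def split: if_splits)
  qed
  show ?thesis
  proof (cases "l + 1 < n")
    case True
    show ?thesis
      by (rule even_line[OF spine_bend[OF sp] l(3,1) ij(1,3)]) (use l ok True in auto)
  next
    case False
    show ?thesis
      by (rule even_line_exception[OF spine_bend[OF sp] l(3) _ ij(1,3), of "A l"]) (use l n ok False in auto)
  qed
qed

text \<open>For odd \<open>n\<close> the path itself is an even line and absorbs one colour at a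
  leaf or an even branch vertex; an odd branch vertex ends a new even line. This leaves only the two
  moves that copy an end colour to the sibling of that end.\<close>

lemma reply_odd:
  assumes sp: "spine n w" and n: "25 \<le> n" "odd n" and ij: "i \<in> {1..3}" "j \<in> {1..3}"
    and st: "\<And>x. in_window n x \<Longrightarrow> clean n i j x (c (w x))"
    and lg: "legal_move V E 3 c v col"
    and esc: "\<not> (v = w (T 1) \<and> col = i)" "\<not> (v = w (T n) \<and> col = j)"
  shows "B_wins_moving (c(v := Some col))"
proof -
  have col: "col \<in> {1..3}" using legal_spineD[OF sp lg] by simp
  show ?thesis
  proof (cases "v \<in> w ` {x. in_window n x}")
    case False
    then have "(c(v := Some col)) (w x) = c (w x)" if "in_window n x" for x using that by auto
    then show ?thesis using n st by (intro clean_window[OF sp _ ij]) auto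
  next
    case True
    then obtain x where x: "v = w x" "in_window n x" by auto
    have cx: "c (w x) = None" using legal_spineD(1)[OF sp lg] x by simp
    have d: "(c(v := Some col)) (w y) = (if y = x then Some col else c (w y))" if "in_window n y" for y
      unfolding x(1) using spine_upd[OF sp x(2) that, of c "Some col"] .
    have exc: "B_wins_moving (c(v := Some col))" if "\<And>l. x \<noteq> U l" "\<And>l. odd l \<Longrightarrow> x \<noteq> T l"
      by (rule even_line_exception[OF sp n(2) _ ij, of x]) (use that n d in \<open>auto simp: clean_imp_line_ok st\<close>)
    show ?thesis
    proof (cases x)
      case (U l)
      then have "1 \<le> l" "l \<le> n" using x cx st[of x] by (auto split: if_splits)
      then show ?thesis using reply_path[OF sp n(1) ij col st] x U by simp
    next
      case (T l)
      then have l: "1 \<le> l" "l \<le> n" using x by auto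
      have "even l \<or> l = 1 \<or> l = n \<or> odd l \<and> 3 \<le> l \<and> l < n" using l by presburger
      then consider "even l" | "l = 1" | "l = n" | "odd l" "3 \<le> l" "l < n" by blast
      then show ?thesis
      proof cases
        case 1 then show ?thesis using exc T by auto
      next
        case 2 then show ?thesis using reply_sibling[OF sp _ ij(1) col _ st] esc x T n by auto
      next
        case 3 then show ?thesis using reply_sibling_right[OF sp _ ij(2) col _ st] esc x T n by auto
      next
        case 4 then show ?thesis using reply_branch[OF sp _ ij col st] x T n by auto
      qed
    qed (use exc in auto)
  qed
qed

text \<open>\<open>y\<close> is a leaf of the window attached to \<open>p\<close>. Its two further
  neighbours are fresh, so \<open>y\<close> can play the role of a branch vertex on a line that
  leaves the window.\<close>

definition leaf :: "nat set \<Rightarrow> (nat \<Rightarrow> nat option) \<Rightarrow> nat \<Rightarrow> nat \<Rightarrow> bool" where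
  "leaf S c y p \<longleftrightarrow> (\<exists>r s. nb E y = {p, r, s} \<and> r \<noteq> s \<and> r \<in> V \<and> s \<in> V \<and> r \<notin> S \<and> s \<notin> S \<and> c r = None \<and> c s = None)"

text \<open>The path from \<open>U 0\<close> through \<open>U l\<close> and \<open>T l\<close> to
  the coloured \<open>A l\<close> has even length \<open>l + 2\<close>. The sibling leaf
  \<open>B l\<close> is its last branch vertex, so its own neighbours must be known.\<close>

lemma reply_leaf:
  assumes sp: "spine n w" and n: "8 \<le> n" and ij: "i \<in> {1..3}" "j \<in> {1..3}" "col \<in> {1..3}"
    and st: "\<And>x. in_window n x \<Longrightarrow> clean n i j x (c (w x))"
    and l: "2 \<le> l" "l \<le> n" "even l" and none: "c (w (B l)) = None"
    and lf: "leaf (w ` {x. in_window n x}) c (w (B l)) (w (T l))"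
  shows "B_wins_moving (c(w (A l) := Some col))"
proof -
  obtain r s where rs: "nb E (w (B l)) = {w (T l), r, s}" "r \<noteq> s" "r \<in> V" "s \<in> V"
    "\<And>x. in_window n x \<Longrightarrow> r \<noteq> w x" "\<And>x. in_window n x \<Longrightarrow> s \<noteq> w x" "c r = None" "c s = None"
    using lf unfolding leaf_def by auto
  have ol: "odd (Suc l)" "odd (l + 1)" using l by auto
  \<comment> \<open>Labels for the path that turns off at \<open>U l\<close>: \<open>T l\<close> and
    \<open>A l\<close> continue it, \<open>U (l + 1)\<close> hangs beside it, and \<open>B l\<close>
    is the last branch vertex, whose leaves \<open>r\<close> and \<open>s\<close> are added by
    \<open>w'\<close>.\<close>
  define h where "h x = (if x = U (l + 1) then T l else if x = U (l + 2) then A l else if x = T l then U (l + 1)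
     else if x = T (l + 1) then B l else x)" for x
  define w' where "w' x = (if x = A (l + 1) then r else if x = B (l + 1) then s else w (h x))" for x
  have inh: "in_window n (h x)" if "in_weak_window (l + 1) x" "x \<noteq> A (l + 1)" "x \<noteq> B (l + 1)" for x
    using that l ol by (cases x) (auto simp: h_def le_Suc_eq Suc_le_eq odd_pos)
  have injh: "h x = h y \<Longrightarrow> x = y" if "in_weak_window (l + 1) x" "in_weak_window (l + 1) y" for x y
    using that l by (cases x; cases y) (auto simp: h_def split: if_splits)
  have sp': "weak_spine (l + 1) w'"
    unfolding weak_spine_def
  proof (intro conjI allI impI)
    show "inj_on w' {x. in_weak_window (l + 1) x}"
    proof (rule inj_onI, unfold mem_Collect_eq)
      fix x y assume xy: "in_weak_window (l + 1) x" "in_weak_window (l + 1) y" "w' x = w' y"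
      show "x = y"
        using xy(3) rs(2) rs(5)[OF inh[OF xy(1)]] rs(5)[OF inh[OF xy(2)]] rs(6)[OF inh[OF xy(1)]] rs(6)[OF inh[OF xy(2)]]
          spineD(2)[OF sp inh[OF xy(1)] inh[OF xy(2)]] injh[OF xy(1,2)]
        by (auto simp: w'_def split: if_splits)
    qed
    show "w' x \<in> V" if "in_weak_window (l + 1) x" for x
      using that rs spineD(1)[OF sp inh[OF that]] by (auto simp: w'_def)
    show "nb E (w' x) = w' ` cell_nb x" if cx: "weak_inner (l + 1) x" for x
    proof (cases x)
      case (U k)
      then have k: "1 \<le> k" "k \<le> l + 1" using cx by auto
      show ?thesis
      proof (cases "k = l + 1")
        case True
        then show ?thesis using U spineD(3)[OF sp, of "T l"] l by (auto simp: w'_def h_def)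
      next
        case False
        then show ?thesis using U k spineD(3)[OF sp, of "U k"] l by (auto simp: w'_def h_def)
      qed
    next
      case (T k)
      then have k: "odd k" "k \<le> l + 1" using cx by auto
      show ?thesis
      proof (cases "k = l + 1")
        case True
        then show ?thesis using T rs(1) l by (auto simp: w'_def h_def)
      next
        case False
        then have "k < l" using k l by presburger
        then show ?thesis using T k spineD(3)[OF sp, of "T k"] l by (auto simp: w'_def h_def elim: oddE)
      qed
    qed (use cx in auto)
  qed
  have d: "(c(w (A l) := Some col)) (w x) = (if x = A l then Some col else c (w x))" if "in_window n x" for x
    using spine_upd[OF sp, of "A l" x c "Some col"] that l by simp
  have drs: "(c(w (A l) := Some col)) r = None" "(c(w (A l) := Some col)) s = None"
    using rs l by auto
  have ok: "line_ok (l + 1) i col x ((c(w (A l) := Some col)) (w' x))"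
    if x: "in_weak_window (l + 1) x" "l < n \<or> x \<noteq> T l" for x
  proof (cases "x = A (l + 1) \<or> x = B (l + 1)")
    case True
    then show ?thesis using drs by (auto simp: w'_def)
  next
    case False
    then have in': "in_window n (h x)" using inh x by auto
    have w'x: "w' x = w (h x)" using False by (simp add: w'_def)
    show ?thesis unfolding w'x d[OF in']
      using st[OF in'] x False none l ol by (cases x) (auto simp: h_def le_Suc_eq split: if_splits)
  qed
  show ?thesis
  proof (cases "l < n")
    case True
    show ?thesis
      by (rule even_line_w[OF sp' ol(2) _ ij(1,3)]) (use l ok True in auto)
  next
    case False
    \<comment> \<open>For \<open>l = n\<close> the vertex beside the line at the even position
      \<open>l\<close> is the coloured end \<open>U (n + 1)\<close>; it is the one
      exception.\<close>
    show ?thesis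
      by (rule even_line_exception_w[OF sp' ol(2) _ ij(1,3), of "T l"]) (use l n ok False in auto)
  qed
qed

lemma leaf_mono: "leaf S c y p \<Longrightarrow> S' \<subseteq> S \<Longrightarrow> (\<And>r. r \<notin> S \<Longrightarrow> c' r = c r) \<Longrightarrow> leaf S' c' y p"
  unfolding leaf_def by (metis subsetD)

text \<open>For even \<open>n\<close> the positions \<open>l\<close> and \<open>n + 1 - l\<close>
  have opposite parity, so an odd position is even when seen from the other end.\<close>

lemma reply_leaf_any:
  assumes sp: "spine n w" and n: "8 \<le> n" "even n" and ij: "i \<in> {1..3}" "j \<in> {1..3}" "col \<in> {1..3}"
    and st: "\<And>x. in_window n x \<Longrightarrow> clean n i j x (c (w x))"
    and l: "1 \<le> l" "l \<le> n" and none: "c (w (B l)) = None"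
    and lf: "leaf (w ` {x. in_window n x}) c (w (B l)) (w (T l))"
  shows "B_wins_moving (c(w (A l) := Some col))"
proof (cases "even l")
  case True
  then have "2 \<le> l" using l by presburger
  then show ?thesis using reply_leaf[OF sp n(1) ij st _ l(2) True none lf] by simp
next
  case False
  let ?w = "w \<circ> mirror_cell n"
  have w: "?w (A (n + 1 - l)) = w (A l)" "?w (B (n + 1 - l)) = w (B l)" "?w (T (n + 1 - l)) = w (T l)"
    using l by auto
  have sub: "?w ` {x. in_window n x} \<subseteq> w ` {x. in_window n x}"
  proof
    fix v assume "v \<in> ?w ` {x. in_window n x}"
    then obtain x where x: "in_window n x" "v = w (mirror_cell n x)" by auto
    have "in_window n (mirror_cell n x)" using x by (cases x) auto
    then show "v \<in> w ` {x. in_window n x}" using x by auto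
  qed
  have "B_wins_moving (c(?w (A (n + 1 - l)) := Some col))"
  proof (rule reply_leaf[OF spine_mirror[OF sp] n(1) ij(2,1,3)])
    show "clean n j i x (c (?w x))" if "in_window n x" for x
      using n that st by (intro clean_mirror[of n i j c w]) auto
    show "leaf (?w ` {x. in_window n x}) c (?w (B (n + 1 - l))) (?w (T (n + 1 - l)))"
      unfolding w using leaf_mono[OF lf sub] by simp
    show "c (?w (B (n + 1 - l))) = None" unfolding w by (rule none)
    show "2 \<le> n + 1 - l" "n + 1 - l \<le> n" "even (n + 1 - l)" using l n False by presburger+
  qed
  then show ?thesis unfolding w .
qed

text \<open>For even \<open>n\<close> the path itself is no even line and cannot absorb stray
  colours, so a move at a branch vertex or leaf must become the end of a new even line, taken from
  the end of the right parity. The hypotheses on leaves let both leaves of a branch be coloured, as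
  at a protected end, but not just one of them.\<close>

lemma reply_even:
  assumes sp: "spine n w" and n: "25 \<le> n" "even n" and ij: "i \<in> {1..3}" "j \<in> {1..3}"
    and st: "\<And>x. in_window n x \<Longrightarrow> clean n i j x (c (w x))"
    and lf: "\<And>l. 1 \<le> l \<Longrightarrow> l \<le> n \<Longrightarrow> c (w (A l)) = None \<Longrightarrow>
        c (w (B l)) = None \<and> leaf (w ` {x. in_window n x}) c (w (B l)) (w (T l))"
      "\<And>l. 1 \<le> l \<Longrightarrow> l \<le> n \<Longrightarrow> c (w (B l)) = None \<Longrightarrow>
        c (w (A l)) = None \<and> leaf (w ` {x. in_window n x}) c (w (A l)) (w (T l))"
    and lg: "legal_move V E 3 c v col"
    and esc: "\<not> (v = w (T 1) \<and> col = i)" "\<not> (v = w (T n) \<and> col = j)"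
  shows "B_wins_moving (c(v := Some col))"
proof -
  have col: "col \<in> {1..3}" using legal_spineD[OF sp lg] by simp
  have n8: "8 \<le> n" using n by simp
  show ?thesis
  proof (cases "v \<in> w ` {x. in_window n x}")
    case False
    then have "(c(v := Some col)) (w x) = c (w x)" if "in_window n x" for x using that by auto
    then show ?thesis using n st by (intro clean_window[OF sp _ ij]) auto
  next
    case True
    then obtain x where x: "v = w x" "in_window n x" by auto
    have cx: "c (w x) = None" using legal_spineD(1)[OF sp lg] x by simp
    show ?thesis
    proof (cases x)
      case (U l)
      then have "1 \<le> l" "l \<le> n" using x cx st[of x] by (auto split: if_splits)
      then show ?thesis using reply_path[OF sp n(1) ij col st] x U by simp
    next
      case (T l)
      then have l: "1 \<le> l" "l \<le> n" using x by auto
      have "l = 1 \<or> l = n \<or> odd l \<and> 3 \<le> l \<and> l < n \<or> even l \<and> 2 \<le> l \<and> l < n" using l n by presburger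
      then consider "l = 1" | "l = n" | "odd l" "3 \<le> l" "l < n" | "even l" "2 \<le> l" "l < n" by blast
      then show ?thesis
      proof cases
        case 1 then show ?thesis using reply_sibling[OF sp _ ij(1) col _ st] esc x T n by auto
      next
        case 2 then show ?thesis using reply_sibling_right[OF sp _ ij(2) col _ st] esc x T n by auto
      next
        case 3 then show ?thesis using reply_branch[OF sp _ ij col st] x T n by auto
      next
        case 4
        \<comment> \<open>Seen from the right end, the position \<open>n + 1 - l\<close> is
          odd.\<close>
        have "B_wins_moving (c((w \<circ> mirror_cell n) (T (n + 1 - l)) := Some col))"
        proof (rule reply_branch[OF spine_mirror[OF sp] n8 ij(2,1) col])
          show "clean n j i x (c ((w \<circ> mirror_cell n) x))" if "in_window n x" for x
            using n that st by (intro clean_mirror[of n i j c w]) auto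
          show "3 \<le> n + 1 - l" "n + 1 - l < n" "odd (n + 1 - l)" using 4 n by presburger+
        qed
        then show ?thesis using x T l by simp
      qed
    next
      case (A l)
      then show ?thesis using reply_leaf_any[OF sp n8 n(2) ij col st, of l] lf(1)[of l] cx x by auto
    next
      case (B l)
      have "B_wins_moving (c((w \<circ> swap_cell) (A l) := Some col))"
      proof (rule reply_leaf_any[OF spine_swap[OF sp] n8 n(2) ij col])
        show "clean n i j x (c ((w \<circ> swap_cell) x))" if "in_window n x" for x
          using st[of "swap_cell x"] that by (cases x) auto
        have sub: "(w \<circ> swap_cell) ` {x. in_window n x} \<subseteq> w ` {x. in_window n x}"
        proof
          fix v assume "v \<in> (w \<circ> swap_cell) ` {x. in_window n x}"
          then obtain x where x: "in_window n x" "v = w (swap_cell x)" by auto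
          have "in_window n (swap_cell x)" using x by (cases x) auto
          then show "v \<in> w ` {x. in_window n x}" using x by auto
        qed
        have l: "1 \<le> l" "l \<le> n" using x B by auto
        then show "1 \<le> l" "l \<le> n" by auto
        have "leaf (w ` {x. in_window n x}) c (w (A l)) (w (T l))" "c (w (A l)) = None"
          using lf(2)[of l] l cx B by auto
        then show "c ((w \<circ> swap_cell) (B l)) = None"
          "leaf ((w \<circ> swap_cell) ` {x. in_window n x}) c ((w \<circ> swap_cell) (B l)) ((w \<circ> swap_cell) (T l))"
          using leaf_mono[OF _ sub] by auto
      qed
      then show ?thesis using x B by simp
    qed
  qed
qed

lemma clean_uncoloured: "spine n w \<Longrightarrow> 1 \<le> n \<Longrightarrow> (\<And>x. in_window n x \<Longrightarrow> clean n i j x (c (w x))) \<Longrightarrow>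
   w (U 1) \<in> V \<and> c (w (U 1)) = None"
proof -
  assume a: "spine n w" "1 \<le> n" "\<And>x. in_window n x \<Longrightarrow> clean n i j x (c (w x))"
  have "in_window n (U 1)" by simp
  then show ?thesis using spineD(1)[OF a(1)] a(3)[of "U 1"] a(2) by auto
qed

text \<open>The two escapes in an odd window copy an end colour to \<open>T 1\<close> or
  \<open>T n\<close>; with that colour already on an adjacent leaf they are illegal.\<close>

lemma odd_window_both_protected:
  assumes sp: "spine n w" and n: "25 \<le> n" "odd n" and ij: "i \<in> {1..3}" "j \<in> {1..3}"
    and st: "\<And>x. in_window n x \<Longrightarrow> clean n i j x (c (w x))"
    and prot: "c (w (A 1)) = Some i" "c (w (A n)) = Some j"
  shows "B_wins_waiting c"
proof (rule not_A_wins_A_move[of "w (U 1)"])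
  show "w (U 1) \<in> V" "c (w (U 1)) = None" using clean_uncoloured[OF sp _ st] n by auto
  fix v col assume lg: "legal_move V E 3 c v col"
  have "\<not> (v = w (T 1) \<and> col = i)" "\<not> (v = w (T n) \<and> col = j)"
    using legal_spineD(4)[OF sp lg, of "T 1" "A 1"] legal_spineD(4)[OF sp lg, of "T n" "A n"] n prot by auto
  then show "B_wins_moving (c(v := Some col))" using reply_odd[OF sp n ij st lg] by blast
qed

text \<open>The protection leaves A only the escape \<open>j\<close> at the last branch vertex. B
  answers with \<open>j\<close> on the branch before it and bends the path there; this gives an odd
  window protected at both ends, with A to move.\<close>

lemma even_window_left_protected:
  assumes sp: "spine (Suc k) w" and k: "25 \<le> k" "odd k" and ij: "i \<in> {1..3}" "j \<in> {1..3}"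
    and st: "\<And>x. in_window (Suc k) x \<Longrightarrow> clean (Suc k) i j x (c (w x))"
    and prot: "c (w (A 1)) = Some i"
    and lf: "\<And>l. 1 \<le> l \<Longrightarrow> l \<le> Suc k \<Longrightarrow> c (w (A l)) = None \<Longrightarrow>
        c (w (B l)) = None \<and> leaf (w ` {x. in_window (Suc k) x}) c (w (B l)) (w (T l))"
      "\<And>l. 1 \<le> l \<Longrightarrow> l \<le> Suc k \<Longrightarrow> c (w (B l)) = None \<Longrightarrow>
        c (w (A l)) = None \<and> leaf (w ` {x. in_window (Suc k) x}) c (w (A l)) (w (T l))"
  shows "B_wins_waiting c"
proof (rule not_A_wins_A_move[of "w (U 1)"])
  show "w (U 1) \<in> V" "c (w (U 1)) = None" using clean_uncoloured[OF sp _ st] k by auto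
  fix v col assume lg: "legal_move V E 3 c v col"
  show "B_wins_moving (c(v := Some col))"
  proof (cases "v = w (T (Suc k)) \<and> col = j")
    case False
    moreover have "\<not> (v = w (T 1) \<and> col = i)"
      using legal_spineD(4)[OF sp lg, of "T 1" "A 1"] prot by auto
    ultimately show ?thesis using k by (intro reply_even[OF sp _ _ ij st lf lg]) auto
  next
    case True
    define c2 where "c2 = c(w (T (Suc k)) := Some j)"
    have u2: "c2 (w y) = (if y = T (Suc k) then Some j else c (w y))" if "in_window (Suc k) y" for y
      unfolding c2_def using spine_upd[OF sp _ that, of "T (Suc k)" c "Some j"] by simp
    define c3 where "c3 = c2(w (T k) := Some j)"
    have u3: "c3 (w y) = (if y = T k \<or> y = T (Suc k) then Some j else c (w y))" if "in_window (Suc k) y" for y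
      unfolding c3_def using spine_upd[OF sp _ that, of "T k" c2 "Some j"] u2[OF that] k by auto
    have lg3: "legal_move V E 3 c2 (w (T k)) j"
      using st[of "U k"] st[of "A k"] st[of "B k"] st[of "T k"] k ij by (intro cell_move[OF sp]) (auto simp: u2)
    have "B_wins_waiting c3"
    proof (rule odd_window_both_protected[OF spine_bend[OF sp, of k] _ _ ij])
      show "clean k i j x (c3 ((w \<circ> bend_cell k) x))" if x: "in_window k x" for x
      proof -
        have "in_window (Suc k) (bend_cell k x)" using x k by (cases x) (auto simp: bend_cell_def)
        then show ?thesis using st[of "bend_cell k x"] u3[of "bend_cell k x"] x k
          by (cases x) (auto simp: bend_cell_def split: if_splits)
      qed
      show "c3 ((w \<circ> bend_cell k) (A 1)) = Some i" using prot u3[of "A 1"] k by (auto simp: bend_cell_def)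
      show "c3 ((w \<circ> bend_cell k) (A k)) = Some j" using u3[of "U (k + 2)"] st[of "U (k + 2)"] by (auto simp: bend_cell_def)
    qed (use k in auto)
    then have "B_wins_moving c2" using not_A_wins_B_move[OF lg3] by (simp add: c3_def)
    then show ?thesis using True by (simp add: c2_def)
  qed
qed

text \<open>B answers \<open>i\<close> at \<open>T 1\<close> by \<open>i\<close> at
  \<open>T 2\<close> and takes \<open>T 2\<close> as the new end. \<open>U 0\<close> and
  \<open>T 1\<close> become its first leaves and protect it, at the price of one step and an even
  window. The later bend costs another step, hence 27 = 25 + 2.\<close>

lemma sibling_killed:
  assumes sp: "spine n w" and n: "27 \<le> n" "odd n" and ij: "i \<in> {1..3}" "j \<in> {1..3}"
    and st: "\<And>x. in_window n x \<Longrightarrow> clean n i j x (c (w x))"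
    and none: "\<And>l. 1 \<le> l \<Longrightarrow> l \<le> n \<Longrightarrow> c (w (A l)) = None \<and> c (w (B l)) = None \<and>
        leaf (w ` {x. in_window n x}) c (w (A l)) (w (T l)) \<and> leaf (w ` {x. in_window n x}) c (w (B l)) (w (T l))"
  shows "B_wins_moving (c(w (T 1) := Some i))"
proof -
  obtain k where k: "n = Suc (Suc k)" using n by (cases n; cases "n - 1") auto
  define c2 where "c2 = c(w (T 1) := Some i)"
  have u2: "c2 (w y) = (if y = T 1 then Some i else c (w y))" if "in_window n y" for y
    unfolding c2_def using spine_upd[OF sp _ that, of "T 1" c "Some i"] k by simp
  define c3 where "c3 = c2(w (T 2) := Some i)"
  have u3: "c3 (w y) = (if y = T 1 \<or> y = T 2 then Some i else c (w y))" if "in_window n y" for y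
    unfolding c3_def using spine_upd[OF sp _ that, of "T 2" c2 "Some i"] u2[OF that] k by auto
  have c3out: "c3 r = c r" if "r \<notin> w ` {x. in_window n x}" for r
    using that k by (auto simp: c3_def c2_def)
  have lg3: "legal_move V E 3 c2 (w (T 2)) i"
    using st[of "U 2"] none[of 2] st[of "T 2"] n ij by (intro cell_move[OF sp]) (auto simp: u2)
  have inl: "in_window n (branch_cell x)" if "in_window (Suc k) x" for x
    using that k by (cases x) auto
  have sub: "(w \<circ> branch_cell) ` {x. in_window (Suc k) x} \<subseteq> w ` {x. in_window n x}" using inl by auto
  have "B_wins_waiting c3"
  proof (rule even_window_left_protected[of k, OF _ _ _ ij])
    show "spine (Suc k) (w \<circ> branch_cell)" using spine_branch[OF sp] k by simp
    show "25 \<le> k" "odd k" using n k by auto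
    show "clean (Suc k) i j x (c3 ((w \<circ> branch_cell) x))" if x: "in_window (Suc k) x" for x
      using st[OF inl[OF x]] u3[OF inl[OF x]] x k by (cases x) (auto split: if_splits)
    show "c3 ((w \<circ> branch_cell) (A 1)) = Some i" using u3[of "U 0"] st[of "U 0"] by simp
    fix l assume l: "1 \<le> l" "l \<le> Suc k"
    have nn: "l \<noteq> 1 \<Longrightarrow> c3 ((w \<circ> branch_cell) (A l)) = None \<and> c3 ((w \<circ> branch_cell) (B l)) = None \<and>
       leaf ((w \<circ> branch_cell) ` {x. in_window (Suc k) x}) c3 ((w \<circ> branch_cell) (A l)) ((w \<circ> branch_cell) (T l)) \<and>
       leaf ((w \<circ> branch_cell) ` {x. in_window (Suc k) x}) c3 ((w \<circ> branch_cell) (B l)) ((w \<circ> branch_cell) (T l))"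
      using none[of "l + 1"] l k u3[of "A (l + 1)"] u3[of "B (l + 1)"] leaf_mono[OF _ sub c3out] by auto
    \<comment> \<open>Both leaves at position 1 are coloured, so the conditions on uncoloured leaves
      are vacuous there.\<close>
    have "c3 ((w \<circ> branch_cell) (A 1)) = Some i" "c3 ((w \<circ> branch_cell) (B 1)) = Some i"
      using u3[of "U 0"] st[of "U 0"] u3[of "T 1"] k by auto
    then show "c3 ((w \<circ> branch_cell) (A l)) = None \<Longrightarrow> c3 ((w \<circ> branch_cell) (B l)) = None \<and>
       leaf ((w \<circ> branch_cell) ` {x. in_window (Suc k) x}) c3 ((w \<circ> branch_cell) (B l)) ((w \<circ> branch_cell) (T l))"
      "c3 ((w \<circ> branch_cell) (B l)) = None \<Longrightarrow> c3 ((w \<circ> branch_cell) (A l)) = None \<and>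
       leaf ((w \<circ> branch_cell) ` {x. in_window (Suc k) x}) c3 ((w \<circ> branch_cell) (A l)) ((w \<circ> branch_cell) (T l))"
      using nn by (cases "l = 1"; auto)+
  qed
  then have "B_wins_moving c2" using not_A_wins_B_move[OF lg3] by (simp add: c3_def)
  then show ?thesis by (simp add: c2_def)
qed

text \<open>The goal of the case analysis: with all leaves still free, B wins even though A is to
  move. The two escapes of an odd window are the killed siblings at either end, related by
  mirroring.\<close>

lemma odd_window_waiting:
  assumes sp: "spine n w" and n: "27 \<le> n" "odd n" and ij: "i \<in> {1..3}" "j \<in> {1..3}"
    and st: "\<And>x. in_window n x \<Longrightarrow> clean n i j x (c (w x))"
    and none: "\<And>l. 1 \<le> l \<Longrightarrow> l \<le> n \<Longrightarrow> c (w (A l)) = None \<and> c (w (B l)) = None \<and>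
        leaf (w ` {x. in_window n x}) c (w (A l)) (w (T l)) \<and> leaf (w ` {x. in_window n x}) c (w (B l)) (w (T l))"
  shows "B_wins_waiting c"
proof (rule not_A_wins_A_move[of "w (U 1)"])
  show "w (U 1) \<in> V" "c (w (U 1)) = None" using clean_uncoloured[OF sp _ st] n by auto
  fix v col assume lg: "legal_move V E 3 c v col"
  consider "v = w (T 1)" "col = i" | "v = w (T n)" "col = j"
    | "\<not> (v = w (T 1) \<and> col = i)" "\<not> (v = w (T n) \<and> col = j)" by blast
  then show "B_wins_moving (c(v := Some col))"
  proof cases
    case 1
    then show ?thesis using sibling_killed[OF sp n ij st none] by simp
  next
    case 2
    let ?w = "w \<circ> mirror_cell n"
    have inm: "in_window n (mirror_cell n x)" if "in_window n x" for x using that by (cases x) auto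
    have sub: "?w ` {x. in_window n x} \<subseteq> w ` {x. in_window n x}" using inm by auto
    have "B_wins_moving (c(?w (T 1) := Some j))"
    proof (rule sibling_killed[OF spine_mirror[OF sp] n ij(2,1)])
      show "clean n j i x (c (?w x))" if "in_window n x" for x
        using n that st by (intro clean_mirror[of n i j c w]) auto
      show "c (?w (A l)) = None \<and> c (?w (B l)) = None \<and>
        leaf (?w ` {x. in_window n x}) c (?w (A l)) (?w (T l)) \<and> leaf (?w ` {x. in_window n x}) c (?w (B l)) (?w (T l))"
        if "1 \<le> l" "l \<le> n" for l
      proof -
        have "1 \<le> n + 1 - l" "n + 1 - l \<le> n" using that by auto
        from none[OF this] show ?thesis using leaf_mono[OF _ sub, of c _ _ c] by simp
      qed
    qed
    then show ?thesis using 2 n by simp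
  next
    case 3
    then show ?thesis using reply_odd[OF sp _ n(2) ij st lg] n by simp
  qed
qed

section \<open>Two arms at a common centre\<close>

definition arm :: "(cell \<Rightarrow> nat) \<Rightarrow> nat set \<Rightarrow> bool" where
  "arm w F \<longleftrightarrow> spine 28 w \<and> w ` {x. in_window 28 x} \<subseteq> F \<and>
     (\<forall>l. 1 \<le> l \<and> l \<le> 28 \<longrightarrow> (\<forall>y\<in>{A l, B l}. \<exists>r s. nb E (w y) = {w (T l), r, s} \<and> r \<noteq> s \<and> r \<in> V \<and> s \<in> V \<and>
        r \<in> F - w ` {x. in_window 28 x} \<and> s \<in> F - w ` {x. in_window 28 x}))"

text \<open>One move suffices to create both ends of an odd window: B colours \<open>U 28\<close>,
  at even distance from \<open>U 0\<close>, and the window between them has length 27. The set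
  \<open>F\<close> also contains the outer neighbours of the leaves, so they are uncoloured
  too.\<close>

lemma arm_win:
  assumes arm: "arm w F" and i: "i \<in> {1..3}" "c (w (U 0)) = Some i"
    and none: "\<And>v. v \<in> F \<Longrightarrow> v \<noteq> w (U 0) \<Longrightarrow> c v = None"
  shows "B_wins_moving c"
proof -
  have sp: "spine 28 w" and F: "\<And>x. in_window 28 x \<Longrightarrow> w x \<in> F" using arm by (auto simp: arm_def)
  have c0: "c (w x) = None" if "in_window 28 x" "x \<noteq> U 0" for x
    using none[OF F[OF that(1)]] spineD(2)[OF sp that(1), of "U 0"] that by auto
  have armL: "\<exists>r s. nb E (w y) = {w (T l), r, s} \<and> r \<noteq> s \<and> r \<in> V \<and> s \<in> V \<and>
        r \<in> F - w ` {x. in_window 28 x} \<and> s \<in> F - w ` {x. in_window 28 x}"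
    if "1 \<le> l" "l \<le> 28" "y \<in> {A l, B l}" for l y
    using arm that unfolding arm_def by blast
  have in28: "in_window 28 x" if "in_window 27 x" for x using that by (cases x) auto
  have sub: "w ` {x. in_window 27 x} \<subseteq> w ` {x. in_window 28 x}" using in28 by blast
  define c1 where "c1 = c(w (U 28) := Some 1)"
  have u1: "c1 (w y) = (if y = U 28 then Some 1 else c (w y))" if "in_window 28 y" for y
    unfolding c1_def using spine_upd[OF sp _ that, of "U 28" c "Some 1"] by simp
  have lg: "legal_move V E 3 c (w (U 28)) 1"
    by (intro cell_move[OF sp]) (auto simp: c0)
  have "B_wins_waiting c1"
  proof (rule odd_window_waiting[of 27, OF spine_cut[OF sp] _ _ i(1), of 1])
    show "clean 27 i 1 x (c1 (w x))" if "in_window 27 x" for x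
      using that u1[OF in28[OF that]] c0[OF in28[OF that]] i(2) by (cases x) auto
    fix l :: nat assume l: "1 \<le> l" "l \<le> 27"
    have lf: "leaf (w ` {x. in_window 27 x}) c1 (w y) (w (T l))" if y: "y \<in> {A l, B l}" for y
    proof -
      obtain r s where rs: "nb E (w y) = {w (T l), r, s} \<and> r \<noteq> s \<and> r \<in> V \<and> s \<in> V \<and>
        r \<in> F - w ` {x. in_window 28 x} \<and> s \<in> F - w ` {x. in_window 28 x}"
        using armL[OF l(1) _ y] l(2) by auto
      have ne: "q \<noteq> w x" if "q \<in> F - w ` {x. in_window 28 x}" "in_window 28 x" for q x using that by auto
      have cq: "c1 q = None" if q: "q \<in> F - w ` {x. in_window 28 x}" for q
        using ne[OF q, of "U 0"] ne[OF q, of "U 28"] none[of q] q by (auto simp: c1_def)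
      have "r \<notin> w ` {x. in_window 27 x}" "s \<notin> w ` {x. in_window 27 x}" using rs sub by auto
      moreover have "c1 r = None" "c1 s = None" using cq rs by auto
      ultimately show ?thesis unfolding leaf_def
        using rs by (intro exI[of _ r] exI[of _ s]) simp
    qed
    show "c1 (w (A l)) = None \<and> c1 (w (B l)) = None \<and>
        leaf (w ` {x. in_window 27 x}) c1 (w (A l)) (w (T l)) \<and> leaf (w ` {x. in_window 27 x}) c1 (w (B l)) (w (T l))"
      using lf l u1[of "A l"] u1[of "B l"] c0[of "A l"] c0[of "B l"] by auto
  qed auto
  then show ?thesis using not_A_wins_B_move[OF lg] by (simp add: c1_def)
qed

text \<open>B colours the centre. A's next move meets at most one of the arms, since they share only
  the coloured centre, and B wins in the other.\<close>

lemma two_arms_win: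
  assumes "arm w F" "arm w' F'" "w (U 0) = x" "w' (U 0) = x" "F \<inter> F' = {x}" "u \<notin> F \<union> F'"
  shows "B_wins_moving ((\<lambda>_. None)(u := Some a))"
proof -
  \<comment> \<open>A colour different from \<open>a\<close> is legal at the centre even if
    \<open>u\<close> is its third neighbour.\<close>
  obtain i where i: "i \<in> {1..3}" "i \<noteq> a" using colour_avoiding2[of a a] by auto
  have sp: "spine 28 w" using assms(1) by (simp add: arm_def)
  have xV: "x \<in> V" using spineD(1)[OF sp, of "U 0"] assms(3) by simp
  have xu: "x \<noteq> u" using assms(5,6) by auto
  let ?c = "(\<lambda>_. None)(u := Some a, x := Some i)"
  have lg: "legal_move V E 3 ((\<lambda>_. None)(u := Some a)) x i"
    using i xV xu by (auto simp: legal_move_def nbr_colours_nb)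
  have "B_wins_waiting ?c"
  proof (rule not_A_wins_A_move[of "w (U 1)"])
    show "w (U 1) \<in> V" using spineD(1)[OF sp, of "U 1"] by simp
    have "w (U 1) \<in> F" using assms(1) by (auto simp: arm_def)
    moreover have "w (U 1) \<noteq> x" using spineD(2)[OF sp, of "U 1" "U 0"] assms(3) by simp
    ultimately show "?c (w (U 1)) = None" using assms(6) by auto
    fix v col assume lg: "legal_move V E 3 ?c v col"
    have "v \<noteq> x" using lg by (auto simp: legal_move_def)
    then have "v \<notin> F \<or> v \<notin> F'" using assms(5) by auto
    then show "B_wins_moving (?c(v := Some col))"
    proof
      assume "v \<notin> F"
      then show ?thesis
        using assms(3,6) i xu \<open>v \<noteq> x\<close> by (intro arm_win[OF assms(1) i(1)]) auto
    next
      assume "v \<notin> F'"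
      then show ?thesis
        using assms(4,6) i xu \<open>v \<noteq> x\<close> by (intro arm_win[OF assms(2) i(1)]) auto
    qed
  qed
  then show ?thesis using not_A_wins_B_move[OF lg] by simp
qed

end

section \<open>Four colours suffice and two do not\<close>

definition pairs :: "nat \<Rightarrow> nat set set" where
  "pairs n = {e. \<exists>u v. e = {u, v} \<and> u \<noteq> v \<and> u < n \<and> v < n}"

lemma card_incident:
  assumes "E \<subseteq> pairs n"
  shows "card {e \<in> E. v \<in> e} = card (nb E v)"
proof -
  have "bij_betw (\<lambda>u. {u, v}) (nb E v) {e \<in> E. v \<in> e}"
  proof (rule bij_betwI')
    fix e assume e: "e \<in> {e \<in> E. v \<in> e}"
    then obtain a b where "e = {a, b}" using assms unfolding pairs_def by blast
    then have "e = {a, v} \<or> e = {b, v}" using e by auto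
    then show "\<exists>x\<in>nb E v. e = {x, v}"
      using e unfolding nb_def by blast
  qed (auto simp: nb_def doubleton_eq_iff)
  then show ?thesis by (simp add: bij_betw_same_card)
qed

lemma cubic_edgeD:
  assumes "E \<in> cubic_graphs n" "{u, v} \<in> E"
  shows "u \<noteq> v" "u < n" "v < n"
  using assms by (auto simp: cubic_graphs_def doubleton_eq_iff)

lemma cubic_nb:
  assumes E: "E \<in> cubic_graphs n"
  shows "nb E v \<subseteq> {0..<n}" "finite (nb E v)" "v \<notin> nb E v" "v < n \<Longrightarrow> card (nb E v) = 3"
proof -
  show sub: "nb E v \<subseteq> {0..<n}" using cubic_edgeD(2)[OF E] by (auto simp: nb_def)
  show "v \<notin> nb E v" using cubic_edgeD(1)[OF E, of v v] by (auto simp: nb_def)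
  show "finite (nb E v)" using sub finite_subset by blast
  show "card (nb E v) = 3" if "v < n"
    using E that card_incident[of E n v] by (simp add: cubic_graphs_def pairs_def)
qed

lemma card_nbr_colours:
  assumes "finite (nb E v)" "card (nb E v) \<le> 3"
  shows "finite (nbr_colours E c v)" "card (nbr_colours E c v) \<le> 3"
proof -
  have sub: "nbr_colours E c v \<subseteq> (the \<circ> c) ` nb E v"
    by (force simp: nbr_colours_nb)
  then show "finite (nbr_colours E c v)" using assms finite_subset by blast
  show "card (nbr_colours E c v) \<le> 3"
    using card_mono[OF _ sub] card_image_le[OF assms(1), of "the \<circ> c"] assms by simp
qed

text \<open>Three neighbours show at most three colours, so no vertex is ever blocked and A wins
  however both sides play; every move lowers the number of uncoloured vertices.\<close>

lemma A_wins_4: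
  assumes V: "finite V" and nb: "\<And>v. finite (nb E v)" "\<And>v. v \<in> V \<Longrightarrow> card (nb E v) \<le> 3"
  shows "A_wins V E 4 t c"
proof (induction "card {v \<in> V. c v = None}" arbitrary: t c rule: less_induct)
  case less
  have free: "\<exists>col\<in>{1..4}. col \<notin> nbr_colours E c v" if "v \<in> V" for v
  proof (rule ccontr)
    assume "\<not> ?thesis"
    then have "{1..4} \<subseteq> nbr_colours E c v" by auto
    then have "card {1..4::nat} \<le> 3"
      using card_mono card_nbr_colours[OF nb(1) nb(2)[OF that]] le_trans by metis
    then show False by simp
  qed
  then have nB: "\<not> B_has_won V E 4 c" by (auto simp: B_has_won_def)
  have step: "A_wins V E 4 t' (c(v := Some col))" if "legal_move V E 4 c v col" for v col t'
  proof (rule less)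
    have "{u \<in> V. (c(v := Some col)) u = None} \<subset> {u \<in> V. c u = None}"
      using that by (auto simp: legal_move_def)
    then show "card {u \<in> V. (c(v := Some col)) u = None} < card {u \<in> V. c u = None}"
      using V by (intro psubset_card_mono) auto
  qed
  show ?case
  proof (cases "all_coloured V c")
    case True then show ?thesis by (rule A_wins.finished)
  next
    case False
    show ?thesis
    proof (cases t)
      case True
      obtain v where v: "v \<in> V" "c v = None" using False by (auto simp: all_coloured_def)
      obtain col where "legal_move V E 4 c v col" using free[OF v(1)] v by (auto simp: legal_move_def)
      then show ?thesis using A_wins.A_move[OF nB False] step True by simp
    next
      case f: False
      then show ?thesis using A_wins.B_move[OF nB False step] by simp
    qed
  qed
qed

lemma not_A_wins_1:
  assumes E: "E \<in> cubic_graphs n" and n: "0 < n"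
  shows "\<not> A_wins {0..<n} E 1 True (\<lambda>_. None)"
proof (rule not_A_wins_A_move[of 0])
  fix v col assume lg: "legal_move {0..<n} E 1 (\<lambda>_. None) v col"
  then have v: "v < n" "col = 1" by (auto simp: legal_move_def)
  obtain u where u: "u \<in> nb E v" using cubic_nb(4)[OF E v(1)] by fastforce
  then have "u < n" "v \<in> nb E u" "u \<noteq> v" using cubic_nb[OF E, of v] nb_sym by auto
  then have "B_has_won {0..<n} E 1 ((\<lambda>_. None)(v := Some col))"
    unfolding B_has_won_def using v by (intro bexI[of _ u]) (auto simp: nbr_colours_nb)
  then show "\<not> A_wins {0..<n} E 1 False ((\<lambda>_. None)(v := Some col))" by (rule B_has_won_imp_not_A_wins)
qed (use n in auto)

lemma not_A_wins_2:
  assumes E: "E \<in> cubic_graphs n" and n: "0 < n"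
  shows "\<not> A_wins {0..<n} E 2 True (\<lambda>_. None)"
proof (rule not_A_wins_A_move[of 0])
  fix v col assume lg: "legal_move {0..<n} E 2 (\<lambda>_. None) v col"
  then have v: "v < n" "col = 1 \<or> col = 2" by (auto simp: legal_move_def)
  obtain y where y: "y \<in> nb E v" using cubic_nb(4)[OF E v(1)] by fastforce
  then have y': "y < n" "v \<in> nb E y" "y \<noteq> v" using cubic_nb[OF E, of v] nb_sym by auto
  have "card (nb E y - {v}) = 2" using cubic_nb[OF E, of y] y' by simp
  then obtain z where z: "z \<in> nb E y" "z \<noteq> v" by (metis Diff_iff card.empty ex_in_conv insertCI zero_neq_numeral)
  then have z': "z < n" "z \<noteq> y" using cubic_nb[OF E, of y] by auto
  let ?c = "(\<lambda>_. None)(v := Some col, z := Some (3 - col))"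
  \<comment> \<open>\<open>z\<close> may be adjacent to \<open>v\<close>; the move is still legal
    because its colour differs from \<open>col\<close>.\<close>
  have "legal_move {0..<n} E 2 ((\<lambda>_. None)(v := Some col)) z (3 - col)"
    using v z z' by (auto simp: legal_move_def nbr_colours_nb)
  moreover have "B_has_won {0..<n} E 2 ?c"
    unfolding B_has_won_def
  proof (intro bexI conjI)
    have "{col, 3 - col} \<subseteq> nbr_colours E ?c y" using y' z by (auto simp: nbr_colours_nb)
    moreover have "{col, 3 - col} = {1..2}" using v(2) by auto
    ultimately show "{1..2} \<subseteq> nbr_colours E ?c y" by simp
  qed (use y' z' in auto)
  ultimately show "\<not> A_wins {0..<n} E 2 False ((\<lambda>_. None)(v := Some col))"
    using not_A_wins_B_move B_has_won_imp_not_A_wins by blast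
qed (use n in auto)

text \<open>A win of A with fewer colours does not visibly yield one with more, so the values 1, 2
  and 3 are excluded separately.\<close>

lemma game_chromatic_number_4:
  assumes E: "E \<in> cubic_graphs n" and n: "0 < n"
    and B: "\<And>u a. u < n \<Longrightarrow> \<not> A_wins {0..<n} E 3 False ((\<lambda>_. None)(u := Some a))"
  shows "game_chromatic_number {0..<n} E = 4"
  unfolding game_chromatic_number_def
proof (rule Least_equality)
  show "0 < (4::nat) \<and> A_wins {0..<n} E 4 True (\<lambda>_. None)"
    using cubic_nb[OF E] by (intro conjI A_wins_4) auto
  fix k assume k: "0 < k \<and> A_wins {0..<n} E k True (\<lambda>_. None)"
  have "\<not> A_wins {0..<n} E 3 True (\<lambda>_. None)"
    by (rule not_A_wins_A_move[of 0]) (use n B in \<open>auto simp: legal_move_def\<close>)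
  then have "k \<noteq> 1" "k \<noteq> 2" "k \<noteq> 3"
    using k not_A_wins_1[OF E n] not_A_wins_2[OF E n] by auto
  then show "4 \<le> k" using k by linarith
qed

section \<open>Arms in tree-like neighbourhoods\<close>

fun nonbacktracking :: "nat set set \<Rightarrow> nat list \<Rightarrow> bool" where
  "nonbacktracking E (x # y # z # zs) = (x \<in> nb E y \<and> x \<noteq> z \<and> nonbacktracking E (y # z # zs))"
| "nonbacktracking E [x, y] = (x \<in> nb E y)"
| "nonbacktracking E _ = True"

text \<open>Cycles are vertex lists, counted once for every starting point and orientation; only
  upper bounds on their number are used.\<close>

definition is_cycle :: "nat set set \<Rightarrow> nat list \<Rightarrow> bool" where
  "is_cycle E xs \<longleftrightarrow> 3 \<le> length xs \<and> distinct xs \<and>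
     (\<forall>i<length xs. {xs ! i, xs ! (Suc i mod length xs)} \<in> E)"

lemma nonbacktracking_Cons: "nonbacktracking E (x # xs) \<Longrightarrow> nonbacktracking E xs"
  by (cases xs rule: list.exhaust; cases "tl xs") auto

lemma nonbacktracking_nth: "nonbacktracking E xs \<Longrightarrow> Suc i < length xs \<Longrightarrow> xs ! i \<in> nb E (xs ! Suc i)"
proof (induction xs arbitrary: i)
  case (Cons x xs)
  then obtain y ys where xs: "xs = y # ys" by (cases xs) auto
  show ?case
  proof (cases i)
    case 0
    then show ?thesis using Cons.prems xs by (cases ys) auto
  next
    case (Suc j)
    then show ?thesis using Cons.IH[of j] Cons.prems nonbacktracking_Cons by auto
  qed
qed simp

text \<open>Take the shortest suffix that repeats a vertex: its first vertex \<open>x\<close>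
  returns at position \<open>j\<close> of a distinct rest. The absence of loops excludes
  \<open>j = 0\<close> and the absence of backtracking excludes \<open>j = 1\<close>, so the part up
  to the return is a cycle.\<close>

lemma nonbacktracking_cycle:
  assumes "\<And>v. v \<notin> nb E v"
  shows "nonbacktracking E xs \<Longrightarrow> \<not> distinct xs \<Longrightarrow> \<exists>ys. is_cycle E ys \<and> length ys \<le> length xs \<and> set ys \<subseteq> set xs"
proof (induction xs)
  case (Cons x xs)
  show ?case
  proof (cases "distinct xs")
    case False
    then obtain ys where "is_cycle E ys" "length ys \<le> length xs" "set ys \<subseteq> set xs"
      using Cons.IH nonbacktracking_Cons[OF Cons.prems(1)] by auto
    then show ?thesis by (intro exI[of _ ys]) auto
  next
    case True
    then have "x \<in> set xs" using Cons.prems by simp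
    then obtain j where j: "j < length xs" "xs ! j = x" by (auto simp: in_set_conv_nth)
    have adj: "(x # xs) ! i \<in> nb E ((x # xs) ! Suc i)" if "i < length xs" for i
      using nonbacktracking_nth[OF Cons.prems(1), of i] that by simp
    have "j \<noteq> 0" using adj[of 0] assms j by (cases "j = 0") auto
    moreover have "j \<noteq> 1"
    proof
      assume "j = 1"
      then obtain a b c where "xs = a # b # c" using j by (cases xs; cases "tl xs") auto
      then show False using Cons.prems(1) j \<open>j = 1\<close> by simp
    qed
    ultimately have j2: "2 \<le> j" by simp
    let ?ys = "x # take j xs"
    have len: "length ?ys = Suc j" using j by simp
    have "x \<notin> set (take j xs)"
    proof
      assume "x \<in> set (take j xs)"
      then obtain i where "i < j" "xs ! i = x" by (auto simp: in_set_conv_nth)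
      then show False using True j nth_eq_iff_index_eq[of xs i j] by auto
    qed
    then have "distinct ?ys" using True by simp
    moreover have "{?ys ! i, ?ys ! (Suc i mod length ?ys)} \<in> E" if i: "i < length ?ys" for i
    proof -
      have ysn: "?ys ! k = (x # xs) ! k" if "k \<le> j" for k
        using that by (cases k) auto
      have "(x # xs) ! i \<in> nb E ((x # xs) ! Suc i)" using adj[of i] i j by simp
      then have e: "{(x # xs) ! i, (x # xs) ! Suc i} \<in> E" by (simp add: nb_def)
      show ?thesis
      proof (cases "i = j")
        case True
        then show ?thesis using e ysn[of j] len j by simp
      next
        case False
        then have "Suc i \<le> j" using i len by simp
        then show ?thesis using e ysn[of i] ysn[of "Suc i"] len by simp
      qed
    qed
    ultimately have "is_cycle E ?ys" unfolding is_cycle_def using j2 len by auto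
    moreover have "set ?ys \<subseteq> set (x # xs)" using set_take_subset[of j xs] by auto
    ultimately show ?thesis using len j by (intro exI[of _ ?ys]) auto
  qed
qed simp

text \<open>The condition concerns three consecutive vertices, so walks can be glued along an
  overlap of two.\<close>

lemma nonbacktracking_append:
  "nonbacktracking E (xs @ [x, y]) \<Longrightarrow> nonbacktracking E (x # y # ys) \<Longrightarrow> nonbacktracking E (xs @ x # y # ys)"
proof (induction xs)
  case (Cons a xs)
  then have "nonbacktracking E (xs @ x # y # ys)" using nonbacktracking_Cons[of E a "xs @ [x, y]"] by simp
  then show ?case using Cons.prems by (cases xs; cases "tl xs") auto
qed simp

lemma nonbacktracking_rev: "nonbacktracking E xs \<Longrightarrow> nonbacktracking E (rev xs)"
proof (induction xs)
  case (Cons x xs)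
  show ?case
  proof (cases xs)
    case (Cons y ys)
    note xs = Cons
    show ?thesis
    proof (cases ys)
      case Nil
      then show ?thesis using Cons.prems xs nb_sym by auto
    next
      case (Cons z zs)
      have "nonbacktracking E (rev xs)" using Cons.IH nonbacktracking_Cons[OF Cons.prems] by simp
      then have "nonbacktracking E (rev zs @ [z, y])" using xs Cons by simp
      moreover have "nonbacktracking E (z # y # [x])" using Cons.prems xs Cons nb_sym by (cases zs) auto
      ultimately have "nonbacktracking E (rev zs @ z # y # [x])" by (rule nonbacktracking_append)
      then show ?thesis using xs Cons by simp
    qed
  qed simp
qed simp

section \<open>Walks coded by turns, and balls\<close>

locale cubic =
  fixes n :: nat and E :: "nat set set"
  assumes E: "E \<in> cubic_graphs n"
begin

text \<open>Fixes an arbitrary order of the two ways on when \<open>q\<close> is entered from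
  \<open>p\<close>, so that nonbacktracking walks correspond to lists of booleans.\<close>

definition other_nbs :: "nat \<Rightarrow> nat \<Rightarrow> nat \<times> nat" where
  "other_nbs p q = (SOME ab. nb E q = {p, fst ab, snd ab} \<and> fst ab \<noteq> snd ab \<and> fst ab \<noteq> p \<and> snd ab \<noteq> p)"

definition next_vertex :: "nat \<Rightarrow> nat \<Rightarrow> bool \<Rightarrow> nat" where
  "next_vertex p q b = (if b then snd (other_nbs p q) else fst (other_nbs p q))"

lemma next_vertex:
  assumes "p \<in> nb E q"
  shows "nb E q = {p, next_vertex p q False, next_vertex p q True}" "next_vertex p q False \<noteq> next_vertex p q True" "next_vertex p q b \<noteq> p" "next_vertex p q b \<in> nb E q"
proof -
  have "q < n" using assms cubic_nb(1)[OF E, of p] nb_sym by auto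
  then have "card (nb E q) = 3" using cubic_nb(4)[OF E] by simp
  then have "card (nb E q - {p}) = 2" using assms cubic_nb(2)[OF E, of q] by simp
  then obtain a a' where "nb E q - {p} = {a, a'}" "a \<noteq> a'" by (auto simp: card_2_iff)
  then have "nb E q = {p, fst (a, a'), snd (a, a')} \<and> fst (a, a') \<noteq> snd (a, a') \<and> fst (a, a') \<noteq> p \<and> snd (a, a') \<noteq> p"
    using assms by auto
  then have "nb E q = {p, fst (other_nbs p q), snd (other_nbs p q)} \<and> fst (other_nbs p q) \<noteq> snd (other_nbs p q) \<and> fst (other_nbs p q) \<noteq> p \<and> snd (other_nbs p q) \<noteq> p"
    unfolding other_nbs_def by (rule someI)
  then show "nb E q = {p, next_vertex p q False, next_vertex p q True}" "next_vertex p q False \<noteq> next_vertex p q True" "next_vertex p q b \<noteq> p" "next_vertex p q b \<in> nb E q"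
    by (auto simp: next_vertex_def)
qed

fun walk_end :: "nat \<Rightarrow> nat \<Rightarrow> bool list \<Rightarrow> nat" where
  "walk_end p q [] = q"
| "walk_end p q (b # bs) = walk_end q (next_vertex p q b) bs"

fun walk :: "nat \<Rightarrow> nat \<Rightarrow> bool list \<Rightarrow> nat list" where
  "walk p q [] = [q]"
| "walk p q (b # bs) = q # walk q (next_vertex p q b) bs"

lemma walk_simps [simp]: "length (walk p q bs) = Suc (length bs)" "walk p q bs \<noteq> []" "hd (walk p q bs) = q"
  "last (walk p q bs) = walk_end p q bs"
  by (induction bs arbitrary: p q) auto

lemma nonbacktracking_walk: "p \<in> nb E q \<Longrightarrow> nonbacktracking E (p # walk p q bs)"
proof (induction bs arbitrary: p q)
  case (Cons b bs)
  have "q \<in> nb E (next_vertex p q b)" using next_vertex(4)[OF Cons.prems] nb_sym by blast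
  from Cons.IH[OF this] show ?case using Cons.prems next_vertex(3)[OF Cons.prems, of b] by (cases bs) auto
qed simp

text \<open>Locally every cubic graph looks like a binary tree of turns: one step back and two steps
  on. Short cycles matter only for whether different lists of turns end in different
  vertices.\<close>

lemma nb_walk_end:
  "p \<in> nb E q \<Longrightarrow> nb E (walk_end p q bs) = {(if bs = [] then p else walk_end p q (butlast bs)), walk_end p q (bs @ [False]), walk_end p q (bs @ [True])}"
proof (induction bs arbitrary: p q)
  case Nil
  then show ?case using next_vertex(1)[OF Nil] by simp
next
  case (Cons b bs)
  have "q \<in> nb E (next_vertex p q b)" using next_vertex(4)[OF Cons.prems] nb_sym by blast
  from Cons.IH[OF this] show ?case by simp
qed

fun nbhd :: "nat \<Rightarrow> nat \<Rightarrow> nat set" where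
  "nbhd 0 x = {x}"
| "nbhd (Suc r) x = nbhd r x \<union> (\<Union>y\<in>nbhd r x. nb E y)"

lemma nbhd_mono: "r \<le> s \<Longrightarrow> nbhd r x \<subseteq> nbhd s x"
  by (induction rule: dec_induct) auto

lemma card_nbhd: "x < n \<Longrightarrow> finite (nbhd r x) \<and> nbhd r x \<subseteq> {0..<n} \<and> card (nbhd r x) \<le> 4 ^ r"
proof (induction r)
  case (Suc r)
  have "card (nbhd (Suc r) x) \<le> card (nbhd r x) + card (\<Union>y\<in>nbhd r x. nb E y)"
    by (simp add: card_Un_le)
  also have "card (\<Union>y\<in>nbhd r x. nb E y) \<le> (\<Sum>y\<in>nbhd r x. card (nb E y))"
    using Suc by (intro card_UN_le) auto
  also have "\<dots> \<le> (\<Sum>y\<in>nbhd r x. 3)"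
    using Suc cubic_nb(4)[OF E] by (intro sum_mono) fastforce
  finally show ?case using Suc cubic_nb(1,2)[OF E] by (auto simp: subset_iff)
qed simp

text \<open>The recursion extends a walk at its far end, so the reversed statement needs
  \<open>step\<close>, which adds an edge at the centre.\<close>

lemma nbhd_sym: "y \<in> nbhd r x \<Longrightarrow> x \<in> nbhd r y"
proof -
  have step: "z \<in> nbhd (Suc r) x" if "z \<in> nbhd r y" "y \<in> nb E x" for z r x y
    using that
  proof (induction r arbitrary: z)
    case 0 then show ?case by auto
  next
    case (Suc r)
    then consider "z \<in> nbhd r y" | u where "u \<in> nbhd r y" "z \<in> nb E u" by auto
    then show ?case
    proof cases
      case 1 then show ?thesis using Suc by auto
    next
      case 2 then have "u \<in> nbhd (Suc r) x" using Suc by blast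
      then show ?thesis using 2 by auto
    qed
  qed
  show "y \<in> nbhd r x \<Longrightarrow> x \<in> nbhd r y"
  proof (induction r arbitrary: y)
    case (Suc r)
    then consider "y \<in> nbhd r x" | u where "u \<in> nbhd r x" "y \<in> nb E u" by auto
    then show ?case
    proof cases
      case 1 then show ?thesis using Suc by auto
    next
      case 2 then show ?thesis using Suc.IH[of u] step[of x r u y] nb_sym by blast
    qed
  qed simp
qed

lemma walk_nbhd: "q \<in> nbhd r x \<Longrightarrow> p \<in> nb E q \<Longrightarrow> set (walk p q bs) \<subseteq> nbhd (r + length bs) x"
proof (induction bs arbitrary: p q r)
  case (Cons b bs)
  have 1: "next_vertex p q b \<in> nbhd (Suc r) x" using next_vertex(4)[OF Cons.prems(2), of b] Cons.prems(1) by auto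
  have 2: "q \<in> nb E (next_vertex p q b)" using next_vertex(4)[OF Cons.prems(2)] nb_sym by blast
  have "q \<in> nbhd (Suc r + length bs) x" using Cons.prems(1) nbhd_mono[of r "Suc r + length bs" x] by auto
  then show ?case using Cons.IH[OF 1 2] by simp
qed simp

end

lemma hd_last_distinct: "distinct xs \<Longrightarrow> 2 \<le> length xs \<Longrightarrow> hd xs \<noteq> last xs"
  by (cases xs) auto

lemma replicate_True_eq: "replicate a False @ True # xs = replicate b False @ True # ys \<longleftrightarrow> a = b \<and> xs = ys"
proof (induction a arbitrary: b)
  case 0 then show ?case by (cases b) auto
next
  case (Suc a) then show ?case by (cases b) auto
qed

lemma replicate_True_ne: "replicate a False \<noteq> replicate b False @ True # ys"
  "replicate b False @ True # ys \<noteq> replicate a False"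
  by (metis in_set_conv_decomp in_set_replicate)+

context cubic
begin

lemma fork_nonbacktracking:
  assumes "q1 \<in> nb E p" "q2 \<in> nb E p" "q1 \<noteq> q2"
  shows "nonbacktracking E (rev (walk p q1 bs) @ p # walk p q2 bs')"
proof -
  obtain rs where rs: "rev (walk p q1 bs) = rs @ [q1]" by (cases bs) auto
  obtain ts where ts: "walk p q2 bs' = q2 # ts" by (cases bs') auto
  have p: "p \<in> nb E q1" "p \<in> nb E q2" using assms nb_sym by blast+
  have "nonbacktracking E (rev (p # walk p q1 bs))" by (intro nonbacktracking_rev nonbacktracking_walk p)
  then have "nonbacktracking E (rs @ [q1, p])" using rs by simp
  moreover have "nonbacktracking E (q1 # p # q2 # ts)" using nonbacktracking_walk[OF p(2), of bs'] ts assms by simp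
  ultimately have "nonbacktracking E (rs @ q1 # p # q2 # ts)" by (rule nonbacktracking_append)
  then show ?thesis using rs ts by simp
qed

end

text \<open>An arm of length 28 with the neighbours of its leaves has radius 31, and a closed walk that leaves
  its first vertex in two directions and stays in it has at most \<open>2 * 31 + 1\<close> vertices.\<close>

locale cubic_tree = cubic +
  fixes x :: nat
  assumes xn: "x < n"
    and no_cycle: "\<And>ys. is_cycle E ys \<Longrightarrow> length ys \<le> 63 \<Longrightarrow> \<not> set ys \<subseteq> nbhd 31 x"
begin

lemma distinct_nonbacktracking: "nonbacktracking E xs \<Longrightarrow> set xs \<subseteq> nbhd 31 x \<Longrightarrow> length xs \<le> 63 \<Longrightarrow> distinct xs"
  using nonbacktracking_cycle[of E xs] cubic_nb(3)[OF E] no_cycle by (meson le_trans subset_trans)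

lemma x_nbhd: "x \<in> nbhd r x"
  by (induction r) auto

lemma fork_ends_ne:
  assumes "q1 \<in> nb E p" "q2 \<in> nb E p" "q1 \<noteq> q2" "length bs \<le> 30" "length bs' \<le> 30"
    "set (walk p q1 bs) \<subseteq> nbhd 31 x" "set (walk p q2 bs') \<subseteq> nbhd 31 x" "p \<in> nbhd 31 x"
  shows "walk_end p q1 bs \<noteq> walk_end p q2 bs'"
proof -
  let ?l = "rev (walk p q1 bs) @ p # walk p q2 bs'"
  have "distinct ?l" using assms by (intro distinct_nonbacktracking fork_nonbacktracking) auto
  then have "hd ?l \<noteq> last ?l" by (intro hd_last_distinct) auto
  then show ?thesis by (simp add: hd_rev)
qed

text \<open>Strip the common turns. If one list is exhausted, the other walk would return to its
  start; otherwise the walks fork, and their union is a nonbacktracking walk, which is distinct by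
  the absence of short cycles.\<close>

lemma walk_end_inj:
  "p \<in> nb E q \<Longrightarrow> length bs \<le> 30 \<Longrightarrow> length bs' \<le> 30 \<Longrightarrow> set (walk p q bs) \<subseteq> nbhd 31 x \<Longrightarrow>
    set (walk p q bs') \<subseteq> nbhd 31 x \<Longrightarrow> walk_end p q bs = walk_end p q bs' \<Longrightarrow> bs = bs'"
proof (induction bs arbitrary: p q bs')
  case Nil
  show ?case
  proof (cases bs')
    case (Cons b cs)
    have "nonbacktracking E (walk p q bs')" using nonbacktracking_walk[OF Nil.prems(1), of bs'] nonbacktracking_Cons by blast
    then have "distinct (walk p q bs')" using Nil.prems by (intro distinct_nonbacktracking) auto
    then have "hd (walk p q bs') \<noteq> last (walk p q bs')" using Cons by (intro hd_last_distinct) auto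
    then show ?thesis using Nil.prems(6) by simp
  qed simp
next
  case (Cons b bs)
  show ?case
  proof (cases bs')
    case Nil
    have "nonbacktracking E (walk p q (b # bs))" using nonbacktracking_walk[OF Cons.prems(1), of "b # bs"] nonbacktracking_Cons by blast
    then have "distinct (walk p q (b # bs))" using Cons.prems by (intro distinct_nonbacktracking) auto
    then have "hd (walk p q (b # bs)) \<noteq> last (walk p q (b # bs))" by (intro hd_last_distinct) auto
    then show ?thesis using Cons.prems(6) Nil by simp
  next
    case (Cons b' cs)
    note bs' = Cons
    have nb: "next_vertex p q b \<in> nb E q" "next_vertex p q b' \<in> nb E q" using next_vertex(4)[OF Cons.prems(1)] by auto
    show ?thesis
    proof (cases "b = b'")
      case True
      have "q \<in> nb E (next_vertex p q b)" using nb nb_sym by blast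
      then have "bs = cs" using Cons.IH[of q "next_vertex p q b" cs] Cons.prems bs' True by auto
      then show ?thesis using bs' True by simp
    next
      case False
      then have "next_vertex p q b \<noteq> next_vertex p q b'" using next_vertex(2)[OF Cons.prems(1)] by (cases b; cases b') auto
      from fork_ends_ne[OF nb this, of bs cs] show ?thesis using Cons.prems bs' by auto
    qed
  qed
qed

context
  fixes y :: nat
  assumes y: "y \<in> nb E x"
begin

text \<open>The words of leaves have at most 27 + 2 letters and their outer neighbours one more,
  hence the bound 30.\<close>

definition arm_vertices :: "nat set" where
  "arm_vertices = insert x {walk_end x y bs | bs. length bs \<le> 30}"

fun cell_word :: "cell \<Rightarrow> bool list" where
  "cell_word (U l) = replicate (l - 1) False"
| "cell_word (T l) = replicate (l - 1) False @ [True]"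
| "cell_word (A l) = replicate (l - 1) False @ [True, False]"
| "cell_word (B l) = replicate (l - 1) False @ [True, True]"

text \<open>\<open>U 0\<close> needs a case of its own: by truncated subtraction its word would be
  that of \<open>U 1\<close>, which is \<open>y\<close>.\<close>

definition arm_cell :: "cell \<Rightarrow> nat" where
  "arm_cell z = (if z = U 0 then x else walk_end x y (cell_word z))"

lemma xy: "x \<in> nb E y" using y nb_sym by blast

lemma walk_in_nbhd: "length bs \<le> 30 \<Longrightarrow> set (walk x y bs) \<subseteq> nbhd 31 x"
proof -
  assume "length bs \<le> 30"
  moreover have "y \<in> nbhd 1 x" using y by simp
  ultimately show ?thesis using walk_nbhd[OF _ xy, of 1 x bs] nbhd_mono[of "1 + length bs" 31 x] by auto
qed

lemma walk_end_eq: "length bs \<le> 30 \<Longrightarrow> length bs' \<le> 30 \<Longrightarrow> walk_end x y bs = walk_end x y bs' \<longleftrightarrow> bs = bs'"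
  using walk_end_inj[OF xy] walk_in_nbhd by blast

lemma walk_end_ne_x: "length bs \<le> 30 \<Longrightarrow> walk_end x y bs \<noteq> x"
proof -
  assume l: "length bs \<le> 30"
  have "distinct (x # walk x y bs)"
    using l walk_in_nbhd[OF l] x_nbhd by (intro distinct_nonbacktracking nonbacktracking_walk xy) auto
  then have "hd (x # walk x y bs) \<noteq> last (x # walk x y bs)" by (intro hd_last_distinct) auto
  then show ?thesis by simp
qed

lemma arm_vertices_nbhd: "arm_vertices \<subseteq> nbhd 31 x"
proof -
  have "walk_end x y bs \<in> set (walk x y bs)" for bs using last_in_set[of "walk x y bs"] by simp
  then show ?thesis using walk_in_nbhd x_nbhd unfolding arm_vertices_def by blast
qed

lemma walk_end_less: "walk_end x y bs < n"
  using nb_walk_end[OF xy, of bs] cubic_nb(1)[OF E, of "walk_end x y (bs @ [True])"]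
    nb_sym[of "walk_end x y bs" E "walk_end x y (bs @ [True])"] by auto

lemma cell_word_length: "in_window 28 z \<Longrightarrow> length (cell_word z) \<le> 30"
  by (cases z) auto

lemma cell_word_inj: "in_window 28 z \<Longrightarrow> in_window 28 z' \<Longrightarrow> z \<noteq> U 0 \<Longrightarrow> z' \<noteq> U 0 \<Longrightarrow> cell_word z = cell_word z' \<Longrightarrow> z = z'"
  by (cases z; cases z') (auto simp: replicate_True_eq replicate_True_ne replicate_True_ne[symmetric])

lemma arm_cell_spine: "game3.spine {0..<n} E 28 arm_cell"
  unfolding game3.spine_def
proof (intro conjI allI impI)
  show "inj_on arm_cell {x. in_window 28 x}"
  proof (rule inj_onI, unfold mem_Collect_eq)
    fix z z' assume z: "in_window 28 z" "in_window 28 z'" "arm_cell z = arm_cell z'"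
    show "z = z'"
      using z(3) walk_end_ne_x[OF cell_word_length[OF z(1)]] walk_end_ne_x[OF cell_word_length[OF z(2)]]
        walk_end_eq[OF cell_word_length[OF z(1)] cell_word_length[OF z(2)]] cell_word_inj[OF z(1,2)]
      by (cases "z = U 0"; cases "z' = U 0") (simp_all add: arm_cell_def)
  qed
  show "arm_cell z \<in> {0..<n}" if "in_window 28 z" for z
    using walk_end_less xn by (simp add: arm_cell_def)
  show "nb E (arm_cell z) = arm_cell ` cell_nb z" if z: "inner 28 z" for z
  proof (cases z)
    case (U l)
    then have l: "1 \<le> l" using z by simp
    show ?thesis
    proof (cases "l = 1")
      case True
      then show ?thesis using U nb_walk_end[OF xy, of "[]"] by (auto simp: arm_cell_def)
    next
      case False
      then obtain k where k: "l = Suc (Suc k)" using l by (cases l; cases "l - 1") auto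
      have "butlast (replicate (Suc k) False) = replicate k False"
        by (metis butlast_snoc replicate_append_same replicate_Suc)
      moreover have "replicate (Suc k) False @ [False] = replicate (Suc (Suc k)) False" by (simp add: replicate_append_same)
      ultimately show ?thesis using U k nb_walk_end[OF xy, of "replicate (Suc k) False"] by (auto simp: arm_cell_def simp del: replicate_Suc)
    qed
  next
    case (T l)
    then show ?thesis using z nb_walk_end[OF xy, of "replicate (l - 1) False @ [True]"] by (auto simp: arm_cell_def)
  qed (use z in auto)
qed

lemma arm_cell_arm: "game3.arm {0..<n} E arm_cell arm_vertices"
  unfolding game3.arm_def
proof (intro conjI allI impI ballI)
  show "game3.spine {0..<n} E 28 arm_cell" by (rule arm_cell_spine)
  have inF: "arm_cell z \<in> arm_vertices" if "in_window 28 z" for z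
    using cell_word_length[OF that] by (auto simp: arm_cell_def arm_vertices_def)
  then show "arm_cell ` {x. in_window 28 x} \<subseteq> arm_vertices" by auto
  fix l z assume l: "1 \<le> l \<and> l \<le> 28" and z: "z \<in> {A l, B l}"
  define ws where "ws = replicate (l - 1) False @ [True, z = B l]"
  have wz: "arm_cell z = walk_end x y ws" "arm_cell (T l) = walk_end x y (butlast ws)" "ws \<noteq> []" "length ws \<le> 29"
    using z l by (auto simp: arm_cell_def ws_def butlast_append)
  have out: "walk_end x y (ws @ [b]) \<in> arm_vertices - arm_cell ` {x. in_window 28 x}" for b
  proof
    show "walk_end x y (ws @ [b]) \<in> arm_vertices" using wz(4) by (auto simp: arm_vertices_def intro!: exI[of _ "ws @ [b]"])
    show "walk_end x y (ws @ [b]) \<notin> arm_cell ` {x. in_window 28 x}"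
    proof
      assume "walk_end x y (ws @ [b]) \<in> arm_cell ` {x. in_window 28 x}"
      then obtain u where u: "in_window 28 u" "walk_end x y (ws @ [b]) = arm_cell u" by auto
      have "u \<noteq> U 0" using u walk_end_ne_x[of "ws @ [b]"] wz(4) by (auto simp: arm_cell_def)
      then have "ws @ [b] = cell_word u" using u walk_end_eq[OF _ cell_word_length[OF u(1)], of "ws @ [b]"] wz(4) by (auto simp: arm_cell_def)
      \<comment> \<open>Words of cells have at most one letter after their first
        \<open>True\<close>; this word has two.\<close>
      then show False by (cases u) (auto simp: ws_def replicate_True_eq replicate_True_ne)
    qed
  qed
  show "\<exists>r s. nb E (arm_cell z) = {arm_cell (T l), r, s} \<and> r \<noteq> s \<and> r \<in> {0..<n} \<and> s \<in> {0..<n} \<and>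
           r \<in> arm_vertices - arm_cell ` {x. in_window 28 x} \<and> s \<in> arm_vertices - arm_cell ` {x. in_window 28 x}"
    using out[of False] out[of True] nb_walk_end[OF xy, of ws] wz walk_end_less walk_end_eq[of "ws @ [False]" "ws @ [True]"]
    by (intro exI[of _ "walk_end x y (ws @ [False])"] exI[of _ "walk_end x y (ws @ [True])"]) auto
qed

end

text \<open>The arms run through two different neighbours of \<open>x\<close>. They are disjoint
  outside \<open>x\<close> because walks that leave \<open>x\<close> in different directions cannot
  meet within the ball.\<close>

lemma B_wins_avoiding:
  assumes "u \<notin> nbhd 31 x"
  shows "\<not> A_wins {0..<n} E 3 False ((\<lambda>_. None)(u := Some a))"
proof -
  have "card (nb E x) = 3" using cubic_nb(4)[OF E xn] .
  then obtain y y' where y: "y \<in> nb E x" "y' \<in> nb E x" "y \<noteq> y'"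
    by (metis card_le_Suc0_iff_eq cubic_nb(2)[OF E] numeral_3_eq_3 Suc_n_not_le_n Suc_le_mono le_zero_eq nat.distinct(1))
  have "arm_vertices y \<inter> arm_vertices y' = {x}"
  proof -
    have "walk_end x y bs \<noteq> walk_end x y' bs'" if "length bs \<le> 30" "length bs' \<le> 30" for bs bs'
      using fork_ends_ne[OF y that] walk_in_nbhd[OF y(1) that(1)] walk_in_nbhd[OF y(2) that(2)] x_nbhd by blast
    then show ?thesis unfolding arm_vertices_def[OF y(1)] arm_vertices_def[OF y(2)] by blast
  qed
  moreover have "u \<notin> arm_vertices y \<union> arm_vertices y'" using arm_vertices_nbhd[OF y(1)] arm_vertices_nbhd[OF y(2)] assms by auto
  ultimately show ?thesis
    using game3.two_arms_win[OF arm_cell_arm[OF y(1)] arm_cell_arm[OF y(2)]] by (simp add: arm_cell_def[OF y(1)] arm_cell_def[OF y(2)])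
qed

end

section \<open>Counting short cycles\<close>

definition short_cycles :: "nat set set \<Rightarrow> nat list set" where
  "short_cycles E = {ys. is_cycle E ys \<and> length ys \<le> 63}"

lemma is_cycle_set: "E \<in> cubic_graphs n \<Longrightarrow> is_cycle E ys \<Longrightarrow> set ys \<subseteq> {0..<n}"
  using cubic_edgeD(2) unfolding is_cycle_def by (fastforce simp: in_set_conv_nth)

lemma finite_short_cycles:
  assumes "E \<in> cubic_graphs n"
  shows "finite (short_cycles E)"
proof (rule finite_subset)
  show "short_cycles E \<subseteq> {ys. set ys \<subseteq> {0..<n} \<and> length ys \<le> 63}"
    using is_cycle_set[OF assms] by (auto simp: short_cycles_def)
  show "finite {ys. set ys \<subseteq> {0..<n} \<and> length ys \<le> 63}"
    by (rule finite_lists_length_le) simp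
qed

text \<open>The balls of radius 31 around A's vertex and around all vertices on short cycles are too
  small to cover the graph. A vertex outside them serves as the centre, since by symmetry of
  distance its own ball avoids all of these vertices.\<close>

lemma few_short_cycles_imp_4:
  assumes E: "E \<in> cubic_graphs n" and few: "(63 * card (short_cycles E) + 1) * 4 ^ 31 < n"
  shows "game_chromatic_number {0..<n} E = 4"
proof (rule game_chromatic_number_4[OF E])
  show "0 < n" using few by simp
  fix u a assume u: "u < n"
  interpret cubic n E by unfold_locales (rule E)
  define S where "S = insert u (\<Union>ys\<in>short_cycles E. set ys)"
  have fin: "finite (short_cycles E)" using finite_short_cycles[OF E] .
  have finS: "finite S" unfolding S_def using fin by auto
  have S: "S \<subseteq> {0..<n}" unfolding S_def using u is_cycle_set[OF E] by (auto simp: short_cycles_def)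
  have "card (\<Union>ys\<in>short_cycles E. set ys) \<le> (\<Sum>ys\<in>short_cycles E. card (set ys))"
    by (rule card_UN_le[OF fin])
  also have "\<dots> \<le> (\<Sum>ys\<in>short_cycles E. 63)"
    by (intro sum_mono) (auto simp: short_cycles_def intro: le_trans[OF card_length])
  finally have cS: "card S \<le> 63 * card (short_cycles E) + 1"
    unfolding S_def by (simp add: card_insert_if fin le_SucI)
  have "card (\<Union>s\<in>S. nbhd 31 s) \<le> (\<Sum>s\<in>S. card (nbhd 31 s))"
    by (rule card_UN_le[OF finS])
  also have "\<dots> \<le> (\<Sum>s\<in>S. 4 ^ 31)"
    using S card_nbhd[of _ 31] by (intro sum_mono) (auto simp del: nbhd.simps)
  also have "\<dots> \<le> (63 * card (short_cycles E) + 1) * 4 ^ 31"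
    using cS by simp
  also have "\<dots> < n" by (rule few)
  finally have lt: "card (\<Union>s\<in>S. nbhd 31 s) < n" .
  have "finite (nbhd 31 s)" if "s \<in> S" for s
    using card_nbhd[of s 31] S that by (auto simp del: nbhd.simps)
  then have "finite (\<Union>s\<in>S. nbhd 31 s)" using finS by blast
  then have "\<not> {0..<n} \<subseteq> (\<Union>s\<in>S. nbhd 31 s)"
    using card_mono[of "\<Union>s\<in>S. nbhd 31 s" "{0..<n}"] lt by auto
  then obtain x where "x \<in> {0..<n}" "x \<notin> (\<Union>s\<in>S. nbhd 31 s)" by blast
  then have x: "x < n" "\<And>s. s \<in> S \<Longrightarrow> x \<notin> nbhd 31 s" by (auto simp del: nbhd.simps)
  have avoid: "s \<notin> nbhd 31 x" if "s \<in> S" for s using nbhd_sym[of s 31 x] x(2)[OF that] by blast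
  interpret cubic_tree n E x
  proof
    show "x < n" by (rule x(1))
    fix ys assume ys: "is_cycle E ys" "length ys \<le> 63"
    then have "hd ys \<in> set ys" by (cases ys) (auto simp: is_cycle_def)
    moreover from this have "hd ys \<in> S" using ys by (auto simp: S_def short_cycles_def)
    ultimately show "\<not> set ys \<subseteq> nbhd 31 x" using avoid by blast
  qed
  show "\<not> A_wins {0..<n} E 3 False ((\<lambda>_. None)(u := Some a))"
    by (rule B_wins_avoiding) (rule avoid, simp add: S_def)
qed

lemma cubic_graphs_iff: "E \<in> cubic_graphs n \<longleftrightarrow> E \<subseteq> pairs n \<and> (\<forall>v<n. card (nb E v) = 3)"
  using card_incident[of E n] unfolding cubic_graphs_def pairs_def by auto

lemma finite_pairs: "finite (pairs n)"
proof (rule finite_subset)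
  show "pairs n \<subseteq> (\<lambda>(u, v). {u, v}) ` ({0..<n} \<times> {0..<n})" by (force simp: pairs_def)
qed simp

lemma finite_cubic_graphs: "finite (cubic_graphs n)"
  by (rule finite_subset[of _ "Pow (pairs n)"]) (auto simp: cubic_graphs_iff finite_pairs)

section \<open>Switchings\<close>

definition switch_edges :: "nat set set \<Rightarrow> nat \<Rightarrow> nat \<Rightarrow> nat \<Rightarrow> nat \<Rightarrow> nat set set" where
  "switch_edges E u v a b = E - {{u, v}, {a, b}} \<union> {{u, a}, {v, b}}"

text \<open>The four vertices are distinct, and each of them trades exactly one neighbour for a new
  one, so all degrees persist and no multiple edge arises.\<close>

lemma switch_edges_cubic:
  assumes E: "E \<in> cubic_graphs n" and uv: "{u, v} \<in> E" and ab: "{a, b} \<in> E"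
    and d: "a \<notin> {u, v}" "b \<notin> {u, v}" and new: "{u, a} \<notin> E" "{v, b} \<notin> E"
  shows "switch_edges E u v a b \<in> cubic_graphs n"
proof -
  have ne: "u \<noteq> v" "a \<noteq> b" and lt: "u < n" "v < n" "a < n" "b < n"
    using cubic_edgeD[OF E uv] cubic_edgeD[OF E ab] by auto
  let ?E = "switch_edges E u v a b"
  have "?E \<subseteq> pairs n"
    using E d lt unfolding cubic_graphs_iff switch_edges_def by (auto simp: pairs_def)
  moreover have "card (nb ?E w) = 3" if w: "w < n" for w
  proof -
    have c3: "card (nb E w) = 3" "finite (nb E w)" using cubic_nb[OF E] w by auto
    have sw: "card (insert q (S - {p})) = 3" if "card S = 3" "finite S" "p \<in> S" "q \<notin> S" for S and p q :: nat
      using that by (simp add: card_Diff_singleton)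
    consider "w = u" | "w = v" | "w = a" | "w = b" | "w \<notin> {u, v, a, b}" by blast
    then show ?thesis
    proof cases
      case 1
      have "nb ?E w = insert a (nb E w - {v})"
        using 1 ne d by (auto simp: nb_def switch_edges_def doubleton_eq_iff insert_commute)
      then show ?thesis using sw[OF c3, of v a] 1 uv new by (simp add: nb_def insert_commute)
    next
      case 2
      have "nb ?E w = insert b (nb E w - {u})"
        using 2 ne d by (auto simp: nb_def switch_edges_def doubleton_eq_iff insert_commute)
      then show ?thesis using sw[OF c3, of u b] 2 uv new by (simp add: nb_def insert_commute)
    next
      case 3
      have "nb ?E w = insert u (nb E w - {b})"
        using 3 ne d by (auto simp: nb_def switch_edges_def doubleton_eq_iff insert_commute)
      then show ?thesis using sw[OF c3, of b u] 3 ab new by (simp add: nb_def insert_commute)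
    next
      case 4
      have "nb ?E w = insert v (nb E w - {a})"
        using 4 ne d by (auto simp: nb_def switch_edges_def doubleton_eq_iff insert_commute)
      then show ?thesis using sw[OF c3, of a v] 4 ab new by (simp add: nb_def insert_commute)
    next
      case 5
      then have "nb ?E w = nb E w"
        by (auto simp: nb_def switch_edges_def doubleton_eq_iff)
      then show ?thesis using c3 by simp
    qed
  qed
  ultimately show ?thesis by (simp add: cubic_graphs_iff)
qed

lemma switch_edges_inv:
  assumes "{u, v} \<in> E" "{a, b} \<in> E" "{u, a} \<notin> E" "{v, b} \<notin> E"
  shows "switch_edges E u v a b - {{u, a}, {v, b}} \<union> {{u, v}, {a, b}} = E"
  using assms unfolding switch_edges_def by auto

definition cubic_containing :: "nat \<Rightarrow> nat set set \<Rightarrow> nat set set set" where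
  "cubic_containing n F = {E \<in> cubic_graphs n. F \<subseteq> E}"

text \<open>The pairs are ordered, because \<open>(a, b)\<close> and \<open>(b, a)\<close> give
  different switchings. Edges of \<open>F\<close> are barred so that the result still contains
  \<open>F\<close>.\<close>

definition switch_pairs :: "nat set set \<Rightarrow> nat set set \<Rightarrow> nat \<Rightarrow> nat \<Rightarrow> (nat \<times> nat) set" where
  "switch_pairs E F u v = {(a, b). {a, b} \<in> E \<and> {a, b} \<notin> F \<and> a \<notin> {u, v} \<and> b \<notin> {u, v} \<and> {u, a} \<notin> E \<and> {v, b} \<notin> E}"

lemma cubic_containing_cubic: "E \<in> cubic_containing n F \<Longrightarrow> E \<in> cubic_graphs n"
  by (simp add: cubic_containing_def)

lemma finite_cubic_containing: "finite (cubic_containing n F)"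
  by (rule finite_subset[OF _ finite_cubic_graphs[of n]]) (auto simp: cubic_containing_def)

text \<open>Among the \<open>3 * n\<close> oriented edges, at most \<open>5 * 3\<close> start at
  \<open>u\<close>, at \<open>v\<close> or next to \<open>u\<close>, at most \<open>5 * 3\<close>
  end at \<open>u\<close>, at \<open>v\<close> or next to \<open>v\<close>, and at most
  \<open>2 * 63\<close> lie in \<open>F\<close>. That is 156 in all, and \<open>3 * n - 156\<close>
  is at least \<open>n\<close> once \<open>n\<close> is at least 78.\<close>

lemma card_switch_pairs:
  assumes E: "E \<in> cubic_graphs n" and n: "78 \<le> n" and F: "finite F" "card F \<le> 63" and uv: "u < n" "v < n"
  shows "finite (switch_pairs E F u v)" "n \<le> card (switch_pairs E F u v)"
proof -
  define D where "D = (SIGMA a:{0..<n}. nb E a)"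
  have fD: "finite D" unfolding D_def using cubic_nb(2)[OF E] by auto
  have cD: "card D = 3 * n" unfolding D_def using cubic_nb[OF E] by (subst card_SigmaI) auto
  have Dsym: "(a, b) \<in> D \<longleftrightarrow> {a, b} \<in> E" for a b
    unfolding D_def using cubic_edgeD[OF E, of b a] by (auto simp: nb_def insert_commute)
  have sub: "switch_pairs E F u v \<subseteq> D" using Dsym by (auto simp: switch_pairs_def)
  then show "finite (switch_pairs E F u v)" using fD finite_subset by blast
  define X where "X = {u, v} \<union> nb E u"
  define Y where "Y = {u, v} \<union> nb E v"
  define P1 where "P1 = (SIGMA a:X. nb E a)"
  define P2 where "P2 = (\<lambda>(b, a). (a, b)) ` (SIGMA b:Y. nb E b)"
  define P3 where "P3 = (\<Union>f\<in>F. {(a, b). {a, b} = f})"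
  have XY: "finite X" "finite Y" "card X \<le> 5" "card Y \<le> 5" "X \<subseteq> {0..<n}" "Y \<subseteq> {0..<n}"
    unfolding X_def Y_def using cubic_nb[OF E] uv
    by (auto intro!: le_trans[OF card_Un_le] simp: card_insert_if)
  have sig: "finite (SIGMA a:Z. nb E a)" "card (SIGMA a:Z. nb E a) \<le> 15"
    if "finite Z" "card Z \<le> 5" "Z \<subseteq> {0..<n}" for Z
  proof -
    show "finite (SIGMA a:Z. nb E a)" using that cubic_nb(2)[OF E] by auto
    have "card (SIGMA a:Z. nb E a) = (\<Sum>a\<in>Z. card (nb E a))" using that cubic_nb(2)[OF E] by (intro card_SigmaI) auto
    also have "\<dots> = (\<Sum>a\<in>Z. 3)" using that cubic_nb(4)[OF E] by (intro sum.cong) auto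
    finally show "card (SIGMA a:Z. nb E a) \<le> 15" using that by simp
  qed
  have P12: "finite P1" "card P1 \<le> 15" "finite P2" "card P2 \<le> 15"
    unfolding P1_def P2_def using sig[OF XY(1,3,5)] sig[OF XY(2,4,6)]
    by (auto intro: le_trans[OF card_image_le])
  have two: "finite {(a, b). {a, b} = f} \<and> card {(a, b). {a, b} = f} \<le> 2" for f :: "nat set"
  proof (cases "\<exists>a b. f = {a, b}")
    case True
    then obtain a b where f: "f = {a, b}" by blast
    then have s: "{(a, b). {a, b} = f} \<subseteq> {(a, b), (b, a)}" by (auto simp: doubleton_eq_iff)
    show ?thesis using finite_subset[OF s] card_mono[OF _ s] card_insert_le_m1[of 2 "{(b, a)}" "(a, b)"] by auto
  next
    case False
    then have "{(a, b). {a, b} = f} = {}" by auto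
    then show ?thesis by simp
  qed
  have P3: "finite P3" "card P3 \<le> 126"
  proof -
    show "finite P3" unfolding P3_def using F two by auto
    have "card P3 \<le> (\<Sum>f\<in>F. card {(a, b). {a, b} = f})" unfolding P3_def by (rule card_UN_le[OF F(1)])
    also have "\<dots> \<le> (\<Sum>f\<in>F. 2)" using two by (intro sum_mono) auto
    finally show "card P3 \<le> 126" using F by simp
  qed
  have "D \<subseteq> switch_pairs E F u v \<union> (P1 \<union> P2 \<union> P3)"
  proof
    fix ab assume "ab \<in> D"
    then obtain a b where ab: "ab = (a, b)" "{a, b} \<in> E" using Dsym by (cases ab) auto
    have "b \<in> nb E a" "a \<in> nb E b" using ab by (auto simp: nb_def insert_commute)
    then show "ab \<in> switch_pairs E F u v \<union> (P1 \<union> P2 \<union> P3)"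
      using ab by (force simp: switch_pairs_def P1_def P2_def P3_def X_def Y_def nb_def insert_commute)
  qed
  then have "card D \<le> card (switch_pairs E F u v \<union> (P1 \<union> P2 \<union> P3))"
    using \<open>finite (switch_pairs E F u v)\<close> P12 P3 by (intro card_mono) auto
  also have "\<dots> \<le> card (switch_pairs E F u v) + (card P1 + card P2 + card P3)"
    by (meson card_Un_le le_trans add_le_mono order_refl)
  finally show "n \<le> card (switch_pairs E F u v)" using cD P12 P3 n by linarith
qed

text \<open>A switching is undone by choosing a neighbour of \<open>u\<close> and one of \<open>v\<close>, in 9 ways.\<close>

lemma switching:
  assumes n: "78 \<le> n" and F: "finite F" "card F \<le> 63" and e: "{u, v} \<notin> F" "u \<noteq> v" "u < n" "v < n"
  shows "n * card (cubic_containing n (insert {u, v} F)) \<le> 9 * card (cubic_containing n F)"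
proof -
  let ?P = "SIGMA E:cubic_containing n (insert {u, v} F). switch_pairs E F u v"
  let ?Q = "SIGMA E:cubic_containing n F. nb E u \<times> nb E v"
  let ?f = "\<lambda>(E, (a, b)). (switch_edges E u v a b, (a, b))"
  have "n * card (cubic_containing n (insert {u, v} F)) = (\<Sum>E\<in>cubic_containing n (insert {u, v} F). n)" by simp
  also have "\<dots> \<le> (\<Sum>E\<in>cubic_containing n (insert {u, v} F). card (switch_pairs E F u v))"
    by (intro sum_mono card_switch_pairs(2)[OF _ n F e(3,4)]) (auto simp: cubic_containing_def)
  also have "\<dots> = card ?P"
    by (rule card_SigmaI[symmetric]) (use finite_cubic_containing card_switch_pairs(1)[OF cubic_containing_cubic n F e(3,4)] in blast)+
  also have "\<dots> \<le> card ?Q"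
  proof (rule card_inj_on_le)
    \<comment> \<open>The image keeps \<open>(a, b)\<close>, which is all that is needed to reverse
      the switching.\<close>
    show "inj_on ?f ?P"
    proof (rule inj_onI)
      fix p q assume pq: "p \<in> ?P" "q \<in> ?P" "?f p = ?f q"
      obtain E1 a1 b1 where p: "p = (E1, a1, b1)" by (cases p)
      obtain E2 a2 b2 where q: "q = (E2, a2, b2)" by (cases q)
      have eq: "a2 = a1" "b2 = b1" using pq(3) p q by auto
      have a: "E1 \<in> cubic_containing n (insert {u, v} F)" "(a1, b1) \<in> switch_pairs E1 F u v"
        "E2 \<in> cubic_containing n (insert {u, v} F)" "(a1, b1) \<in> switch_pairs E2 F u v"
        "switch_edges E1 u v a1 b1 = switch_edges E2 u v a1 b1"
        using pq p q eq by auto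
      have "E = switch_edges E u v a1 b1 - {{u, a1}, {v, b1}} \<union> {{u, v}, {a1, b1}}"
        if "E \<in> cubic_containing n (insert {u, v} F)" "(a1, b1) \<in> switch_pairs E F u v" for E
        using that switch_edges_inv[of u v E a1 b1] by (simp add: cubic_containing_def switch_pairs_def)
      from this[OF a(1,2)] this[OF a(3,4)] show "p = q" using a(5) p q eq by simp
    qed
    show "?f ` ?P \<subseteq> ?Q"
    proof (rule image_subsetI)
      fix p assume "p \<in> ?P"
      then obtain E a b where p: "p = (E, a, b)"
        and a: "E \<in> cubic_containing n (insert {u, v} F)" "(a, b) \<in> switch_pairs E F u v" by auto
      have "switch_edges E u v a b \<in> cubic_graphs n"
        using a by (intro switch_edges_cubic) (auto simp: cubic_containing_def switch_pairs_def)
      moreover have "F \<subseteq> switch_edges E u v a b" using a e(1) by (auto simp: cubic_containing_def switch_pairs_def switch_edges_def)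
      moreover have "a \<in> nb (switch_edges E u v a b) u" "b \<in> nb (switch_edges E u v a b) v"
        by (auto simp: nb_def switch_edges_def insert_commute)
      ultimately show "?f p \<in> ?Q" by (auto simp: cubic_containing_def p)
    qed
    show "finite ?Q"
      by (rule finite_SigmaI[OF finite_cubic_containing]) (rule finite_cartesian_product; rule cubic_nb(2)[OF cubic_containing_cubic])
  qed
  also have "\<dots> = (\<Sum>E\<in>cubic_containing n F. card (nb E u \<times> nb E v))"
    by (rule card_SigmaI[OF finite_cubic_containing], rule ballI)
      (rule finite_cartesian_product; rule cubic_nb(2)[OF cubic_containing_cubic])
  also have "\<dots> = (\<Sum>E\<in>cubic_containing n F. 9)"
    by (rule sum.cong[OF refl]) (simp add: card_cartesian_product cubic_nb(4)[OF cubic_containing_cubic] e)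
  finally show ?thesis by simp
qed

text \<open>One switching step per edge of \<open>F\<close>. The factor \<open>9 / n\<close> is kept
  as a product on either side, so that everything stays in the natural numbers.\<close>

lemma card_cubic_containing:
  assumes n: "78 \<le> n" and F: "finite F" "F \<subseteq> pairs n" "card F \<le> 63"
  shows "n ^ card F * card (cubic_containing n F) \<le> 9 ^ card F * card (cubic_graphs n)"
  using F
proof (induction F rule: finite_induct)
  case empty
  then show ?case by (simp add: cubic_containing_def)
next
  case (insert e F)
  then obtain u v where uv: "e = {u, v}" "u \<noteq> v" "u < n" "v < n" by (auto simp: pairs_def)
  have IH: "n ^ card F * card (cubic_containing n F) \<le> 9 ^ card F * card (cubic_graphs n)" using insert by simp
  have "n ^ card (insert e F) * card (cubic_containing n (insert e F)) = n ^ card F * (n * card (cubic_containing n (insert e F)))"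
    using insert by simp
  also have "\<dots> \<le> n ^ card F * (9 * card (cubic_containing n F))"
    using switching[OF n insert.hyps(1), of u v] insert uv by (intro mult_left_mono) auto
  also have "\<dots> \<le> 9 * (9 ^ card F * card (cubic_graphs n))"
    using IH by simp
  finally show ?case using insert by simp
qed

section \<open>Expected number of short cycles\<close>

definition cycle_edges :: "nat list \<Rightarrow> nat set set" where
  "cycle_edges ys = (\<lambda>i. {ys ! i, ys ! (Suc i mod length ys)}) ` {0..<length ys}"

lemma is_cycle_iff: "is_cycle E ys \<longleftrightarrow> 3 \<le> length ys \<and> distinct ys \<and> cycle_edges ys \<subseteq> E"
  unfolding is_cycle_def cycle_edges_def by auto

text \<open>Length at least 3 is what makes the edges of consecutive vertices distinct; a list of
  two vertices would give the same edge twice.\<close>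

lemma cycle_edges:
  assumes "3 \<le> length ys" "distinct ys"
  shows "finite (cycle_edges ys)" "card (cycle_edges ys) = length ys"
    "set ys \<subseteq> {0..<n} \<Longrightarrow> cycle_edges ys \<subseteq> pairs n"
proof -
  let ?k = "length ys"
  show "finite (cycle_edges ys)" by (simp add: cycle_edges_def)
  have m: "Suc i mod ?k = (if Suc i = ?k then 0 else Suc i)" if "i < ?k" for i
    using that by auto
  have lt: "Suc i mod ?k < ?k" for i
    using assms(1) by (intro mod_less_divisor) linarith
  have ne: "ys ! i \<noteq> ys ! (Suc i mod ?k)" if "i < ?k" for i
    using that assms(1) nth_eq_iff_index_eq[OF assms(2) that lt, of i] m[OF that] by (auto split: if_splits)
  have "inj_on (\<lambda>i. {ys ! i, ys ! (Suc i mod ?k)}) {0..<?k}"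
  proof (rule inj_onI)
    fix i j assume ij: "i \<in> {0..<?k}" "j \<in> {0..<?k}"
      and eq: "{ys ! i, ys ! (Suc i mod ?k)} = {ys ! j, ys ! (Suc j mod ?k)}"
    show "i = j"
    proof (rule ccontr)
      assume "i \<noteq> j"
      then have "ys ! i \<noteq> ys ! j" using ij assms by (simp add: nth_eq_iff_index_eq)
      then have "ys ! i = ys ! (Suc j mod ?k)" "ys ! j = ys ! (Suc i mod ?k)"
        using eq by (auto simp: doubleton_eq_iff)
      moreover have lt': "i < ?k" "j < ?k" using ij by auto
      ultimately have "i = Suc j mod ?k" "j = Suc i mod ?k"
        using nth_eq_iff_index_eq[OF assms(2) _ lt] by blast+
      then have "i = Suc j \<or> i = 0 \<and> Suc j = ?k" "j = Suc i \<or> j = 0 \<and> Suc i = ?k"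
        using m[OF lt'(1)] m[OF lt'(2)] by metis+
      then show False using assms(1) by linarith
    qed
  qed
  then show "card (cycle_edges ys) = ?k" unfolding cycle_edges_def by (simp add: card_image)
  show "cycle_edges ys \<subseteq> pairs n" if s: "set ys \<subseteq> {0..<n}"
  proof
    fix e assume "e \<in> cycle_edges ys"
    then obtain i where i: "i < ?k" "e = {ys ! i, ys ! (Suc i mod ?k)}" by (auto simp: cycle_edges_def)
    have "ys ! i < n" "ys ! (Suc i mod ?k) < n" using s i(1) lt[of i] by (auto simp: subset_iff)
    then show "e \<in> pairs n" using i ne[OF i(1)] unfolding pairs_def by blast
  qed
qed

text \<open>Double counting: there are \<open>n ^ k\<close> vertex lists, and each is a cycle in at
  most a fraction \<open>(9 / n) ^ k\<close> of the graphs, so the powers of \<open>n\<close>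
  cancel.\<close>

lemma sum_card_cycles:
  assumes n: "78 \<le> n" and k: "k \<le> 63"
  shows "(\<Sum>E\<in>cubic_graphs n. card {ys. is_cycle E ys \<and> length ys = k}) \<le> 9 ^ k * card (cubic_graphs n)"
proof -
  define L where "L = {ys. set ys \<subseteq> {0..<n} \<and> length ys = k}"
  have L: "finite L" "card L = n ^ k"
    unfolding L_def by (auto simp: finite_lists_length_eq card_lists_length_eq)
  have set: "{ys. is_cycle E ys \<and> length ys = k} = {ys \<in> L. is_cycle E ys}" if "E \<in> cubic_graphs n" for E
    using is_cycle_set[OF that] by (auto simp: L_def)
  have le: "n ^ k * card {E \<in> cubic_graphs n. is_cycle E ys} \<le> 9 ^ k * card (cubic_graphs n)" if ys: "ys \<in> L" for ys
  proof (cases "3 \<le> length ys \<and> distinct ys")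
    case True
    then have "{E \<in> cubic_graphs n. is_cycle E ys} = cubic_containing n (cycle_edges ys)" by (auto simp: is_cycle_iff cubic_containing_def)
    then show ?thesis
      using card_cubic_containing[OF n cycle_edges(1), of ys] cycle_edges(2,3)[of ys] True ys k by (simp add: L_def)
  next
    case False
    then have no: "{E \<in> cubic_graphs n. is_cycle E ys} = {}" by (auto simp: is_cycle_iff)
    show ?thesis unfolding no by simp
  qed
  have "(\<Sum>E\<in>cubic_graphs n. card {ys. is_cycle E ys \<and> length ys = k}) = (\<Sum>E\<in>cubic_graphs n. card {ys \<in> L. is_cycle E ys})"
    using set by (intro sum.cong) auto
  also have "\<dots> = (\<Sum>ys\<in>L. card {E \<in> cubic_graphs n. is_cycle E ys})"
    by (rule sum_multicount_gen) (auto simp: L(1) finite_cubic_graphs)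
  finally have "n ^ k * (\<Sum>E\<in>cubic_graphs n. card {ys. is_cycle E ys \<and> length ys = k}) =
      (\<Sum>ys\<in>L. n ^ k * card {E \<in> cubic_graphs n. is_cycle E ys})"
    by (simp add: sum_distrib_left)
  also have "\<dots> \<le> (\<Sum>ys\<in>L. 9 ^ k * card (cubic_graphs n))"
    by (intro sum_mono le)
  also have "\<dots> = n ^ k * (9 ^ k * card (cubic_graphs n))" using L by simp
  finally show ?thesis using n by simp
qed

lemma sum_card_short_cycles:
  assumes n: "78 \<le> n"
  shows "(\<Sum>E\<in>cubic_graphs n. card (short_cycles E)) \<le> (\<Sum>k\<le>63. 9 ^ k) * card (cubic_graphs n)"
proof -
  have "card (short_cycles E) \<le> (\<Sum>k\<le>63. card {ys. is_cycle E ys \<and> length ys = k})" for E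
  proof -
    have "short_cycles E = (\<Union>k\<in>{..63}. {ys. is_cycle E ys \<and> length ys = k})"
      by (auto simp: short_cycles_def)
    then show ?thesis using card_UN_le[of "{..63::nat}"] by simp
  qed
  then have "(\<Sum>E\<in>cubic_graphs n. card (short_cycles E)) \<le>
      (\<Sum>E\<in>cubic_graphs n. \<Sum>k\<le>63. card {ys. is_cycle E ys \<and> length ys = k})"
    by (intro sum_mono)
  also have "\<dots> = (\<Sum>k\<le>63. \<Sum>E\<in>cubic_graphs n. card {ys. is_cycle E ys \<and> length ys = k})"
    by (rule sum.swap)
  also have "\<dots> \<le> (\<Sum>k\<le>63. 9 ^ k * card (cubic_graphs n))"
    using sum_card_cycles[OF n] by (intro sum_mono) auto
  finally show ?thesis by (simp only: sum_distrib_right)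
qed

text \<open>The witness is the Moebius ladder: a cycle with all its long diagonals.\<close>

lemma cubic_graphs_nonempty:
  assumes m: "2 \<le> m"
  shows "cubic_graphs (2 * m) \<noteq> {}"
proof -
  define R where "R i j \<longleftrightarrow> i < j \<and> j < 2 * m \<and> (j = Suc i \<or> i = 0 \<and> Suc j = 2 * m \<or> j = i + m)" for i j
  define E where "E = {{i, j} | i j. R i j}"
  have E: "{u, v} \<in> E \<longleftrightarrow> R u v \<or> R v u" for u v
    unfolding E_def by (auto simp: doubleton_eq_iff)
  have "E \<subseteq> pairs (2 * m)" unfolding E_def R_def pairs_def by force
  moreover have "card (nb E w) = 3" if w: "w < 2 * m" for w
  proof -
    consider "w = 0" | "Suc w = 2 * m" | "0 < w" "w < m" | "m \<le> w" "Suc w < 2 * m" using w by linarith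
    then show ?thesis
    proof cases
      case 1
      then have "nb E w = {1, 2 * m - 1, m}" using m unfolding nb_def E R_def by auto
      then show ?thesis using m by simp
    next
      case 2
      then have "nb E w = {2 * m - 2, 0, m - 1}" using m unfolding nb_def E R_def by auto
      then show ?thesis using m by simp
    next
      case 3
      then have "nb E w = {w - 1, w + 1, w + m}" using m unfolding nb_def E R_def by auto
      then show ?thesis using m 3 by (auto simp: card_insert_if)
    next
      case 4
      then have "nb E w = {w - 1, w + 1, w - m}" using m unfolding nb_def E R_def by auto
      then show ?thesis using m 4 by (auto simp: card_insert_if)
    qed
  qed
  ultimately show ?thesis using cubic_graphs_iff by blast
qed

section \<open>Markov's inequality and the limit\<close>

lemma bad_fraction:
  "\<exists>K. \<forall>n > 2 * 4 ^ 31.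
    real (card {E \<in> cubic_graphs n. game_chromatic_number {0..<n} E \<noteq> 4}) \<le> K / real n * real (card (cubic_graphs n))"
proof -
  define C :: nat where "C = (\<Sum>k\<le>63. 9 ^ k)"
  define b :: nat where "b = 4 ^ 31"
  have b78: "78 \<le> b" unfolding b_def by simp
  have "real (card {E \<in> cubic_graphs n. game_chromatic_number {0..<n} E \<noteq> 4})
      \<le> real (126 * b * C) / real n * real (card (cubic_graphs n))" if n: "n > 2 * b" for n
  proof -
    define X where "X = {E \<in> cubic_graphs n. game_chromatic_number {0..<n} E \<noteq> 4}"
    have X: "finite X" "X \<subseteq> cubic_graphs n" unfolding X_def using finite_cubic_graphs by auto
    have "n \<le> 126 * b * card (short_cycles E)" if E: "E \<in> X" for E
    proof -
      have "n \<le> (63 * card (short_cycles E) + 1) * b"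
        using few_short_cycles_imp_4[of E n] E unfolding X_def b_def[symmetric] by force
      \<comment> \<open>Since \<open>n > 2 * b\<close>, the summand \<open>b\<close> costs less than
        half of \<open>n\<close>; this doubles 63 to 126.\<close>
      then show ?thesis using n by (simp add: algebra_simps)
    qed
    \<comment> \<open>Markov's inequality in counting form: every bad graph has at least
      \<open>n / (126 * b)\<close> short cycles.\<close>
    then have "card X * n \<le> (\<Sum>E\<in>X. 126 * b * card (short_cycles E))"
      by (metis (no_types, lifting) of_nat_id sum_bounded_below)
    also have "\<dots> \<le> (\<Sum>E\<in>cubic_graphs n. 126 * b * card (short_cycles E))"
      using X finite_cubic_graphs by (intro sum_mono2) auto
    also have "\<dots> = 126 * b * (\<Sum>E\<in>cubic_graphs n. card (short_cycles E))"
      by (simp only: sum_distrib_left)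
    also have "\<dots> \<le> 126 * b * (C * card (cubic_graphs n))"
      using sum_card_short_cycles[of n] n b78 unfolding C_def by (intro mult_left_mono) linarith+
    finally have "real (card X * n) \<le> real (126 * b * (C * card (cubic_graphs n)))"
      by (simp only: of_nat_le_iff)
    then show ?thesis unfolding X_def[symmetric] using n by (simp add: field_simps)
  qed
  then show ?thesis unfolding b_def by blast
qed

theorem theorem4:
  shows "(\<lambda>m. real (card {E \<in> cubic_graphs (2 * m).
                   game_chromatic_number {0..<2 * m} E = 4})
             / real (card (cubic_graphs (2 * m)))) \<longlonglongrightarrow> 1"
proof -
  obtain K :: real where K: "\<And>n. n > 2 * 4 ^ 31 \<Longrightarrow>
    real (card {E \<in> cubic_graphs n. game_chromatic_number {0..<n} E \<noteq> 4}) \<le> K / real n * real (card (cubic_graphs n))"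
    using bad_fraction by blast
  let ?r = "\<lambda>m. real (card {E \<in> cubic_graphs (2 * m). game_chromatic_number {0..<2 * m} E = 4})
             / real (card (cubic_graphs (2 * m)))"
  have lim: "(\<lambda>m. 1 - K / 2 / real m) \<longlonglongrightarrow> 1"
    using tendsto_diff[OF tendsto_const lim_const_over_n[of "K / 2"]] by simp
  have lower: "\<forall>\<^sub>F m in sequentially. 1 - K / 2 / real m \<le> ?r m"
  proof (rule eventually_sequentiallyI)
    fix m :: nat assume m: "Suc (4 ^ 31) \<le> m"
    let ?G = "cubic_graphs (2 * m)" and ?g = "game_chromatic_number {0..<2 * m}"
    \<comment> \<open>Without this the quotient would be \<open>0 / 0\<close>, which is 0 by
      convention, and the lower bound could fail.\<close>
    have N: "0 < card ?G"
      using cubic_graphs_nonempty[of m] finite_cubic_graphs m by (simp add: card_gt_0_iff)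
    have "?G = {E \<in> ?G. ?g E = 4} \<union> {E \<in> ?G. ?g E \<noteq> 4}" by auto
    then have "card ?G = card ({E \<in> ?G. ?g E = 4} \<union> {E \<in> ?G. ?g E \<noteq> 4})" by (rule arg_cong)
    also have "\<dots> = card {E \<in> ?G. ?g E = 4} + card {E \<in> ?G. ?g E \<noteq> 4}"
      using finite_cubic_graphs by (intro card_Un_disjoint) auto
    finally have "real (card ?G) = real (card {E \<in> ?G. ?g E = 4}) + real (card {E \<in> ?G. ?g E \<noteq> 4})"
      by linarith
    moreover have "real (card {E \<in> ?G. ?g E \<noteq> 4}) \<le> K / real (2 * m) * real (card ?G)"
      using m by (intro K) linarith
    ultimately have "(1 - K / real (2 * m)) * real (card ?G) \<le> real (card {E \<in> ?G. ?g E = 4})"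
      by (simp add: left_diff_distrib)
    then show "1 - K / 2 / real m \<le> ?r m" using N by (simp add: pos_le_divide_eq)
  qed
  have upper: "\<forall>\<^sub>F m in sequentially. ?r m \<le> 1"
  proof (rule always_eventually, rule allI)
    fix m
    have "card {E \<in> cubic_graphs (2 * m). game_chromatic_number {0..<2 * m} E = 4} \<le> card (cubic_graphs (2 * m))"
      using finite_cubic_graphs by (intro card_mono) auto
    \<comment> \<open>For an empty set of graphs the quotient is 0 by convention.\<close>
    then show "?r m \<le> 1" by (cases "card (cubic_graphs (2 * m)) = 0") auto
  qed
  show ?thesis by (rule tendsto_sandwich[OF lower upper lim tendsto_const])
qed

end
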